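(* Let $F$ be Thompson's group with the elements $x_0,x_1,x_2,\ldots$, let $S=\{x_nu \mid n\ge0,\ u \text{ is a word over } \{x_0,x_1\}\}\subset F$, and let $\Gamma_S$ be the induced subgraph, with vertex set $S$, of the Cayley graph of $F$ with respect to the generating set $\{x_0,x_1\}$. The structure of $\Gamma_S$ is as follows. (a) $\Gamma_S$ contains the infinite binary tree $T$ corresponding to the free submonoid generated by $x_0$ and $x_1$. (b) For each $n\ge2$ there is a binary tree $T_n$ in $\Gamma_S$ consisting of $n-2$ levels which grows from the vertex $x_n$ and does not intersect anything else. (c) Each vertex $x_nv$ of the boundary of $T_n$ (i.e. $v$ has length $n-2$) has two neighbors $x_nvx_1$ and $x_nvx_0$ outside $T_n$. The first one is the root of an infinite binary tree which does not intersect anything else. The second one coincides with the vertex $vx_0x_1$ of the binary tree $T$.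
   Context: Thompson's group $F$ is the group of strictly increasing piecewise linear homeomorphisms of $[0,1]$ that are differentiable except at finitely many dyadic rationals and whose derivatives are integer powers of $2$, with product $(fg)(x)=g(f(x))$. It has the presentation $F\cong\langle x_0,x_1,x_2,\ldots \mid x_kx_n=x_{n+1}x_k,\ 0\le k<n\rangle$; it is generated by $x_0,x_1$, with $x_n=x_0^{n-1}x_1x_0^{-(n-1)}$ for $n\ge1$. The submonoid of $F$ generated by $x_0$ and $x_1$ is free. The Cayley graph of $F$ with respect to $\{x_0,x_1\}$ has vertex set $F$ and, for each $g\in F$ and $i\in\{0,1\}$, an edge from $g$ to $gx_i$ labelled $x_i$. An induced subgraph on a set of vertices contains all edges of the Cayley graph with both endpoints in that set. Words over $\{x_0,x_1\}$ may be empty. In all the binary trees mentioned, the two children of a vertex $g$ are $gx_0$ and $gx_1$. The tree $T_n$ has as vertices the elements $x_nv$ with $v$ a word over $\{x_0,x_1\}$ of length at most $n-2$ (the levels being numbered from $0$, the level of the root $x_n$). The infinite tree rooted at $x_nvx_1$ in (c) has as vertices the elements $x_nvx_1v'$ with $v'$ a word over $\{x_0,x_1\}$. That such a tree "does not intersect anything else" means that none of its vertices, written as the word $x_nv$ (respectively $x_nvx_1v'$), is equal in $F$ to any other word of the form $x_mw$ with $w$ a word over $\{x_0,x_1\}$.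
   Formalization: In (a), the root of T is the identity, which is not in S (no element x_n u is trivial), so T is not literally contained in Γ_S; the formal statement says that T is an infinite binary tree in the Cayley graph of F and that T with its root deleted is contained in Γ_S. *)

theory Defs
  imports "HOL-Analysis.Analysis" "HOL-Algebra.Group" "HOL-Library.Extended_Nat"
    "Graph_Theory.Digraph_Component"
begin

definition dyadic_rationals :: "real set" where
  "dyadic_rationals = {of_int a / 2 ^ n | a n. True}"

definition piecewise_linear :: "(real \<Rightarrow> real) \<Rightarrow> bool" where
  "piecewise_linear f \<longleftrightarrow>
     (\<exists>P. finite P \<and>
        (\<forall>a b. 0 \<le> a \<and> a < b \<and> b \<le> 1 \<and> {a<..<b} \<inter> P = {} \<longrightarrow>
           (\<exists>m c. \<forall>t\<in>{a..b}. f t = m * t + c)))"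

text \<open>Homeomorphisms of the unit interval are represented by functions that are extensional
  on it, so that equality in the group is equality of functions. The product is written in the
  order \<open>(f g)(x) = g (f x)\<close>.\<close>

definition thompson_F :: "(real \<Rightarrow> real) monoid" where
  "thompson_F =
     \<lparr>carrier =
        {f. f \<in> extensional {0..1} \<and>
            (\<exists>g. homeomorphism {0..1} {0..1} f g) \<and>
            strict_mono_on {0..1} f \<and>
            piecewise_linear f \<and>
            (\<exists>D. finite D \<and> D \<subseteq> dyadic_rationals \<and>
               (\<forall>x\<in>{0..1} - D. \<exists>k::int.
                  (f has_real_derivative 2 powi k) (at x within {0..1})))},
      mult = (\<lambda>f g. compose {0..1} g f),
      one = (\<lambda>x\<in>{0..1}. x)\<rparr>"

text \<open>The standard generators, chosen so that with the above product
  \<open>x\<^sub>k x\<^sub>n = x\<^sub>n\<^sub>+\<^sub>1 x\<^sub>k\<close> for \<open>k < n\<close>.\<close>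

definition thompson_x0 :: "real \<Rightarrow> real" where
  "thompson_x0 = (\<lambda>t\<in>{0..1}.
     if t \<le> 1/2 then t / 2 else if t \<le> 3/4 then t - 1/4 else 2 * t - 1)"

definition thompson_x1 :: "real \<Rightarrow> real" where
  "thompson_x1 = (\<lambda>t\<in>{0..1}.
     if t \<le> 1/2 then t else if t \<le> 3/4 then t / 2 + 1/4
     else if t \<le> 7/8 then t - 1/8 else 2 * t - 1)"

definition thompson_x :: "nat \<Rightarrow> real \<Rightarrow> real" where
  "thompson_x n =
     (if n = 0 then thompson_x0
      else thompson_x0 [^]\<^bsub>thompson_F\<^esub> (n - 1) \<otimes>\<^bsub>thompson_F\<^esub> thompson_x1
           \<otimes>\<^bsub>thompson_F\<^esub> inv\<^bsub>thompson_F\<^esub> (thompson_x0 [^]\<^bsub>thompson_F\<^esub> (n - 1)))"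

definition word_prod :: "('a, 'm) monoid_scheme \<Rightarrow> 'a list \<Rightarrow> 'a" where
  "word_prod G w = foldr (\<lambda>a b. a \<otimes>\<^bsub>G\<^esub> b) w \<one>\<^bsub>G\<^esub>"

text \<open>An arc \<open>(g, a, h)\<close> runs from \<open>g\<close> to \<open>h = g a\<close> and carries the label \<open>a\<close>.\<close>

definition cayley_graph ::
  "('a, 'm) monoid_scheme \<Rightarrow> 'a set \<Rightarrow> ('a, 'a \<times> 'a \<times> 'a) pre_digraph" where
  "cayley_graph G A =
     \<lparr>verts = carrier G,
      arcs = {(g, a, g \<otimes>\<^bsub>G\<^esub> a) | g a. g \<in> carrier G \<and> a \<in> A},
      tail = (\<lambda>(g, a, h). g), head = (\<lambda>(g, a, h). h)\<rparr>"

text \<open>The graph growing from \<open>r\<close> through levels \<open>0, \<dots>, d\<close> (all levels if \<open>d = \<infinity>\<close>). It need not be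
  a tree, since different words may give the same vertex; it is a binary tree exactly when
  there are two letters and the words of length at most \<open>d\<close> label its vertices without
  repetition.\<close>

definition growth_graph ::
  "('a, 'm) monoid_scheme \<Rightarrow> 'a set \<Rightarrow> 'a \<Rightarrow> enat \<Rightarrow> ('a, 'a \<times> 'a \<times> 'a) pre_digraph" where
  "growth_graph G A r d =
     \<lparr>verts = {r \<otimes>\<^bsub>G\<^esub> word_prod G w | w. w \<in> lists A \<and> enat (length w) \<le> d},
      arcs = {(r \<otimes>\<^bsub>G\<^esub> word_prod G w, a, r \<otimes>\<^bsub>G\<^esub> word_prod G w \<otimes>\<^bsub>G\<^esub> a) | w a.
                w \<in> lists A \<and> a \<in> A \<and> enat (length w) < d},
      tail = (\<lambda>(g, a, h). g), head = (\<lambda>(g, a, h). h)\<rparr>"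

definition grows_binary_tree :: "('a, 'm) monoid_scheme \<Rightarrow> 'a set \<Rightarrow> 'a \<Rightarrow> enat \<Rightarrow> bool" where
  "grows_binary_tree G A r d \<longleftrightarrow>
     card A = 2 \<and>
     inj_on (\<lambda>w. r \<otimes>\<^bsub>G\<^esub> word_prod G w) {w \<in> lists A. enat (length w) \<le> d}"

definition neighbors :: "('a, 'b) pre_digraph \<Rightarrow> 'a \<Rightarrow> 'a set" where
  "neighbors H g = {h. g \<rightarrow>\<^bsub>H\<^esub> h \<or> h \<rightarrow>\<^bsub>H\<^esub> g}"

abbreviation thompson_gens :: "(real \<Rightarrow> real) set" where
  "thompson_gens \<equiv> {thompson_x 0, thompson_x 1}"

definition thompson_S :: "(real \<Rightarrow> real) set" where
  "thompson_S =
     {thompson_x n \<otimes>\<^bsub>thompson_F\<^esub> word_prod thompson_F u | n u. u \<in> lists thompson_gens}"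

type_synonym thompson_graph =
  "(real \<Rightarrow> real, (real \<Rightarrow> real) \<times> (real \<Rightarrow> real) \<times> (real \<Rightarrow> real)) pre_digraph"

definition thompson_cayley :: thompson_graph where
  "thompson_cayley = cayley_graph thompson_F thompson_gens"

definition Gamma_S :: thompson_graph where
  "Gamma_S = thompson_cayley \<restriction> thompson_S"

definition monoid_tree :: thompson_graph where
  "monoid_tree = growth_graph thompson_F thompson_gens \<one>\<^bsub>thompson_F\<^esub> \<infinity>"

definition level_tree :: "nat \<Rightarrow> thompson_graph" where
  "level_tree n = growth_graph thompson_F thompson_gens (thompson_x n) (enat (n - 2))"

text \<open>The word \<open>x\<^sub>n w\<close> is equal in the group to no other word of the form \<open>x\<^sub>m w'\<close>.\<close>

definition meets_nothing_else :: "nat \<Rightarrow> (real \<Rightarrow> real) list \<Rightarrow> bool" where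
  "meets_nothing_else n w \<longleftrightarrow>
     (\<forall>m. \<forall>w'\<in>lists thompson_gens.
        thompson_x n \<otimes>\<^bsub>thompson_F\<^esub> word_prod thompson_F w
          = thompson_x m \<otimes>\<^bsub>thompson_F\<^esub> word_prod thompson_F w'
        \<longrightarrow> m = n \<and> w' = w)"

lemma dyadic_0: "0 \<in> dyadic_rationals" and dyadic_1: "1 \<in> dyadic_rationals"
proof -
  have "(0::real) = of_int 0 / 2 ^ 0" "(1::real) = of_int 1 / 2 ^ 0" by auto
  then show "0 \<in> dyadic_rationals" "1 \<in> dyadic_rationals"
    unfolding dyadic_rationals_def by blast+
qed

lemma dyadic_add:
  assumes "x \<in> dyadic_rationals" "y \<in> dyadic_rationals"
  shows "x + y \<in> dyadic_rationals"
proof -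
  obtain a m b n where xy: "x = of_int a / 2 ^ m" "y = of_int b / 2 ^ n"
    using assms unfolding dyadic_rationals_def by blast
  have "x + y = of_int (a * 2 ^ n + b * 2 ^ m) / 2 ^ (m + n)"
    unfolding xy by (simp add: add_divide_distrib power_add)
  then show ?thesis unfolding dyadic_rationals_def by blast
qed

lemma dyadic_uminus:
  assumes "x \<in> dyadic_rationals"
  shows "- x \<in> dyadic_rationals"
proof -
  obtain a m where "x = of_int a / 2 ^ m"
    using assms unfolding dyadic_rationals_def by blast
  then have "- x = of_int (- a) / 2 ^ m" by simp
  then show ?thesis unfolding dyadic_rationals_def by blast
qed

lemma dyadic_diff:
  "x \<in> dyadic_rationals \<Longrightarrow> y \<in> dyadic_rationals \<Longrightarrow> x - y \<in> dyadic_rationals"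
  using dyadic_add[of x "- y"] dyadic_uminus by simp

lemma dyadic_mult_powi:
  assumes "x \<in> dyadic_rationals"
  shows "x * 2 powi k \<in> dyadic_rationals"
proof -
  obtain a m where x: "x = of_int a / 2 ^ m"
    using assms unfolding dyadic_rationals_def by blast
  show ?thesis
  proof (cases "k \<ge> 0")
    case True
    then have "x * 2 powi k = of_int (a * 2 ^ nat k) / 2 ^ m"
      by (simp add: x power_int_def)
    then show ?thesis unfolding dyadic_rationals_def by blast
  next
    case False
    then have "x * 2 powi k = of_int a / 2 ^ (m + nat (- k))"
      by (simp add: x power_int_def power_add field_simps)
    then show ?thesis unfolding dyadic_rationals_def by blast
  qed
qed

lemma dyadic_mult_powi_iff:
  "x * 2 powi k \<in> dyadic_rationals \<longleftrightarrow> x \<in> dyadic_rationals"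
proof
  assume "x * 2 powi k \<in> dyadic_rationals"
  then have "x * 2 powi k * 2 powi (- k) \<in> dyadic_rationals" by (rule dyadic_mult_powi)
  then show "x \<in> dyadic_rationals" by (simp add: power_int_minus mult.assoc)
qed (rule dyadic_mult_powi)

lemma thompson_FD:
  assumes "f \<in> carrier thompson_F"
  shows "f \<in> extensional {0..1}" "strict_mono_on {0..1} f" "f ` {0..1} = {0..1}"
    "continuous_on {0..1} f" "f 0 = 0" "f 1 = 1" "inj_on f {0..1}"
proof -
  obtain g where g: "homeomorphism {0..1} {0..1} f g" and e: "f \<in> extensional {0..1}"
    and s: "strict_mono_on {0..1} f"
    using assms by (auto simp: thompson_F_def)
  show "f \<in> extensional {0..1}" "strict_mono_on {0..1} f" by fact+
  show im: "f ` {0..1} = {0..1}" and "continuous_on {0..1} f"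
    using g by (auto simp: homeomorphism_def)
  show "inj_on f {0..1}" using s by (rule strict_mono_on_imp_inj_on)
  have m: "f x \<le> f y" if "x \<in> {0..1}" "y \<in> {0..1}" "x \<le> y" for x y
    using that s by (metis order_le_less strict_mono_onD)
  have "0 \<in> f ` {0..1}" "1 \<in> f ` {0..1}" unfolding im by auto
  then obtain a b where "a \<in> {0..1}" "f a = 0" "b \<in> {0..1}" "f b = 1" by force
  moreover have "f 0 \<in> {0..1}" "f 1 \<in> {0..1}" using im by auto
  ultimately show "f 0 = 0" "f 1 = 1" using m[of 0 a] m[of b 1] by auto
qed

lemma thompson_F_in: "f \<in> carrier thompson_F \<Longrightarrow> x \<in> {0..1} \<Longrightarrow> f x \<in> {0..1}"
  using thompson_FD(3) by blast

lemma thompson_F_less_iff: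
  "f \<in> carrier thompson_F \<Longrightarrow> x \<in> {0..1} \<Longrightarrow> y \<in> {0..1} \<Longrightarrow> f x < f y \<longleftrightarrow> x < y"
  using thompson_FD(2) strict_mono_on_less by blast

lemma thompson_F_le_iff:
  "f \<in> carrier thompson_F \<Longrightarrow> x \<in> {0..1} \<Longrightarrow> y \<in> {0..1} \<Longrightarrow> f x \<le> f y \<longleftrightarrow> x \<le> y"
  by (meson linorder_not_le thompson_F_less_iff)

lemma thompson_F_breaks:
  assumes "f \<in> carrier thompson_F"
  obtains D where "finite D" "D \<subseteq> dyadic_rationals" "{0, 1} \<subseteq> D"
    "\<forall>x\<in>{0..1} - D. \<exists>k::int. (f has_real_derivative 2 powi k) (at x)"
proof -
  obtain D where D: "finite D" "D \<subseteq> dyadic_rationals"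
    "\<forall>x\<in>{0..1} - D. \<exists>k::int. (f has_real_derivative 2 powi k) (at x within {0..1})"
    using assms by (auto simp: thompson_F_def)
  have "\<exists>k::int. (f has_real_derivative 2 powi k) (at x)" if "x \<in> {0..1} - (D \<union> {0, 1})" for x
  proof -
    have "x \<in> interior {0..1}" using that by auto
    then have "at x within {0..1} = at x" by (rule at_within_interior)
    then show ?thesis using D(3) that by (metis Diff_iff UnI1)
  qed
  then show ?thesis using that[of "D \<union> {0, 1}"] D dyadic_0 dyadic_1 by auto
qed

lemma thompson_F_dyadic:
  assumes f: "f \<in> carrier thompson_F" and x: "x \<in> {0..1}"
  shows "f x \<in> dyadic_rationals \<longleftrightarrow> x \<in> dyadic_rationals"
proof -
  obtain D where D: "finite D" "D \<subseteq> dyadic_rationals" "{0, 1} \<subseteq> D"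
    and der: "\<forall>x\<in>{0..1} - D. \<exists>k::int. (f has_real_derivative 2 powi k) (at x)"
    using thompson_F_breaks[OF f] by metis
  show ?thesis using x
  proof (induction "card {e\<in>D. 0 \<le> e \<and> e < x}" arbitrary: x rule: less_induct)
    case less
    show ?case
    proof (cases "x = 0")
      case True
      then show ?thesis using thompson_FD(5)[OF f] by simp
    next
      case False
      let ?E = "{e\<in>D. 0 \<le> e \<and> e < x}"
      have E: "finite ?E" "?E \<noteq> {}" using D False less.prems by auto
      define d where "d = Max ?E"
      have d: "d \<in> ?E" using Max_in[OF E] d_def by simp
      have gap: "y \<notin> D" if "d < y" "y < x" for y
        using Max_ge[OF E(1), of y] that d by (auto simp: d_def[symmetric])
      have "{e\<in>D. 0 \<le> e \<and> e < d} \<subset> ?E" using d by auto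
      then have "card {e\<in>D. 0 \<le> e \<and> e < d} < card ?E" using E(1) by (rule psubset_card_mono[rotated])
      then have IH: "f d \<in> dyadic_rationals"
        using less.hyps[of d] d D less.prems by auto
      have dx: "d < x" "{d..x} \<subseteq> {0..1}" using d less.prems by auto
      have "\<exists>l z. d < z \<and> z < x \<and> DERIV f z :> l \<and> f x - f d = (x - d) * l"
      proof (rule MVT)
        show "continuous_on {d..x} f" using thompson_FD(4)[OF f] dx(2) by (rule continuous_on_subset)
        show "f differentiable at y" if "d < y" "y < x" for y
        proof -
          have "y \<in> {0..1} - D" using gap[OF that] that dx by auto
          then show ?thesis using der real_differentiable_def by blast
        qed
      qed (use dx in auto)
      then obtain l z where z: "d < z" "z < x" "DERIV f z :> l" "f x - f d = (x - d) * l"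
        by blast
      have "z \<in> {0..1} - D" using z gap dx by auto
      then obtain k :: int where "DERIV f z :> 2 powi k" using der by blast
      then have k: "f x - f d = (x - d) * 2 powi k" using z DERIV_unique by blast
      have "f x \<in> dyadic_rationals \<longleftrightarrow> f x - f d \<in> dyadic_rationals"
        using IH dyadic_diff[of "f x" "f d"] dyadic_add[of "f x - f d" "f d"] by auto
      also have "\<dots> \<longleftrightarrow> x - d \<in> dyadic_rationals"
        unfolding k by (rule dyadic_mult_powi_iff)
      also have "\<dots> \<longleftrightarrow> x \<in> dyadic_rationals"
        using d D(2) dyadic_diff[of x d] dyadic_add[of "x - d" d] by auto
      finally show ?thesis .
    qed
  qed
qed

lemma thompson_F_mult_apply:
  "x \<in> {0..1} \<Longrightarrow> (f \<otimes>\<^bsub>thompson_F\<^esub> g) x = g (f x)"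
  by (simp add: thompson_F_def compose_def)

lemma thompson_F_image_ivl:
  assumes f: "f \<in> carrier thompson_F" and ab: "0 \<le> a" "a < b" "b \<le> 1"
    and y: "y \<in> {f a<..<f b}"
  obtains t where "t \<in> {a<..<b}" "y = f t"
proof -
  have "f a \<in> {0..1}" "f b \<in> {0..1}" using thompson_F_in[OF f] ab by auto
  then have "y \<in> f ` {0..1}" using thompson_FD(3)[OF f] y by auto
  then obtain t where t: "t \<in> {0..1}" "y = f t" by blast
  have "a < t" "t < b"
    using y t thompson_F_less_iff[OF f, of a t] thompson_F_less_iff[OF f, of t b] ab by auto
  then show ?thesis using that t by auto
qed

lemma thompson_F_mult_closed:
  assumes f: "f \<in> carrier thompson_F" and g: "g \<in> carrier thompson_F"
  shows "f \<otimes>\<^bsub>thompson_F\<^esub> g \<in> carrier thompson_F"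
proof -
  define h where "h = compose {0..1} g f"
  have h: "h t = g (f t)" if "t \<in> {0..1}" for t using that by (simp add: h_def compose_def)
  have ext: "h \<in> extensional {0..1}" by (simp add: h_def compose_def)
  have mono: "strict_mono_on {0..1} h"
    by (auto simp: strict_mono_on_def h thompson_F_less_iff[OF f] thompson_F_less_iff[OF g]
        thompson_F_in[OF f, simplified])
  obtain f' g' where f': "homeomorphism {0..1} {0..1} f f'" and g': "homeomorphism {0..1} {0..1} g g'"
    using f g by (auto simp: thompson_F_def)
  have "homeomorphism {0..1} {0..1} (g \<circ> f) (f' \<circ> g')"
    using homeomorphism_compose[OF f' g'] .
  then have hom: "homeomorphism {0..1} {0..1} h (f' \<circ> g')"
    by (rule homeomorphism_cong) (auto simp: h)
  obtain P Q where P: "finite P" "\<And>a b. 0 \<le> a \<Longrightarrow> a < b \<Longrightarrow> b \<le> 1 \<Longrightarrow> {a<..<b} \<inter> P = {} \<Longrightarrow>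
      \<exists>m c. \<forall>t\<in>{a..b}. f t = m * t + c"
    and Q: "finite Q" "\<And>a b. 0 \<le> a \<Longrightarrow> a < b \<Longrightarrow> b \<le> 1 \<Longrightarrow> {a<..<b} \<inter> Q = {} \<Longrightarrow>
      \<exists>m c. \<forall>t\<in>{a..b}. g t = m * t + c"
    using f g by (auto simp: thompson_F_def piecewise_linear_def)
  have fin: "finite {t\<in>{0..1}. f t \<in> X}" if "finite X" for X
    using finite_vimage_IntI[OF that thompson_FD(7)[OF f]]
    by (rule finite_subset[rotated]) auto
  have pl: "piecewise_linear h"
    unfolding piecewise_linear_def
  proof (intro exI[of _ "P \<union> {t\<in>{0..1}. f t \<in> Q}"] conjI allI impI)
    show "finite (P \<union> {t\<in>{0..1}. f t \<in> Q})" using P(1) fin[OF Q(1)] by simp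
    fix a b :: real
    assume *: "0 \<le> a \<and> a < b \<and> b \<le> 1 \<and> {a<..<b} \<inter> (P \<union> {t\<in>{0..1}. f t \<in> Q}) = {}"
    then have "{a<..<b} \<inter> P = {}" by blast
    then obtain m c where mc: "\<And>t. t \<in> {a..b} \<Longrightarrow> f t = m * t + c" using P(2)[of a b] * by blast
    have "{f a<..<f b} \<inter> Q = {}"
    proof (rule ccontr)
      assume "{f a<..<f b} \<inter> Q \<noteq> {}"
      then obtain y where "y \<in> {f a<..<f b}" "y \<in> Q" by blast
      then obtain t where "t \<in> {a<..<b}" "f t \<in> Q"
        using thompson_F_image_ivl[OF f, of a b y] * by metis
      moreover from this have "t \<in> {0..1}" using * by auto
      ultimately show False using * by blast
    qed
    moreover have "0 \<le> f a" "f a < f b" "f b \<le> 1"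
      using * thompson_F_in[OF f, of a] thompson_F_in[OF f, of b] thompson_F_less_iff[OF f, of a b] by auto
    ultimately obtain m' c' where mc': "\<And>t. t \<in> {f a..f b} \<Longrightarrow> g t = m' * t + c'"
      using Q(2)[of "f a" "f b"] by blast
    have "h t = (m' * m) * t + (m' * c + c')" if t: "t \<in> {a..b}" for t
    proof -
      have t1: "t \<in> {0..1}" using t * by auto
      have "f t \<in> {f a..f b}"
        using t * t1 thompson_F_le_iff[OF f, of a t] thompson_F_le_iff[OF f, of t b] by auto
      then show ?thesis using h[OF t1] mc' mc[OF t] by (simp add: algebra_simps)
    qed
    then show "\<exists>m c. \<forall>t\<in>{a..b}. h t = m * t + c" by blast
  qed
  obtain D E where D: "finite D" "D \<subseteq> dyadic_rationals"
    "\<forall>x\<in>{0..1} - D. \<exists>k::int. (f has_real_derivative 2 powi k) (at x within {0..1})"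
    and E: "finite E" "E \<subseteq> dyadic_rationals"
    "\<forall>x\<in>{0..1} - E. \<exists>k::int. (g has_real_derivative 2 powi k) (at x within {0..1})"
    using f g by (auto simp: thompson_F_def)
  have "\<exists>k::int. (h has_real_derivative 2 powi k) (at x within {0..1})"
    if x: "x \<in> {0..1} - (D \<union> {t\<in>{0..1}. f t \<in> E})" for x
  proof -
    have "f x \<in> {0..1} - E" using x thompson_F_in[OF f, of x] by auto
    then obtain j :: int where j: "(g has_real_derivative 2 powi j) (at (f x) within f ` {0..1})"
      using E(3) thompson_FD(3)[OF f] by metis
    obtain k :: int where k: "(f has_real_derivative 2 powi k) (at x within {0..1})"
      using D(3) x by blast
    have "(g \<circ> f has_real_derivative 2 powi j * 2 powi k) (at x within {0..1})"
      using DERIV_image_chain[OF j k] .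
    then have "(h has_real_derivative 2 powi (j + k)) (at x within {0..1})"
      using has_field_derivative_transform_within[of "g \<circ> f" _ x "{0..1}" 1 h] x h
      by (simp add: power_int_add)
    then show ?thesis by blast
  qed
  moreover have "finite (D \<union> {t\<in>{0..1}. f t \<in> E})" using D(1) fin[OF E(1)] by simp
  moreover have "D \<union> {t\<in>{0..1}. f t \<in> E} \<subseteq> dyadic_rationals"
    using D(2) E(2) thompson_F_dyadic[OF f] by blast
  ultimately have "\<exists>D. finite D \<and> D \<subseteq> dyadic_rationals \<and> (\<forall>x\<in>{0..1} - D. \<exists>k::int.
      (h has_real_derivative 2 powi k) (at x within {0..1}))"
    by blast
  then have "h \<in> carrier thompson_F" using ext mono hom pl by (auto simp: thompson_F_def)
  then show ?thesis by (simp add: thompson_F_def h_def)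
qed

lemma thompson_F_one_closed: "\<one>\<^bsub>thompson_F\<^esub> \<in> carrier thompson_F"
proof -
  define h :: "real \<Rightarrow> real" where "h = (\<lambda>x\<in>{0..1}. x)"
  have h: "h t = t" if "t \<in> {0..1}" for t using that by (simp add: h_def)
  have "homeomorphism {0..1} {0..1} h id"
    using homeomorphism_cong[of "{0..1}" "{0..1}" id id "{0..1}" "{0..1}" h id]
    by (auto simp: h homeomorphism_ident id_def)
  moreover have "strict_mono_on {0..1} h" by (auto simp: strict_mono_on_def h)
  moreover have "piecewise_linear h"
    unfolding piecewise_linear_def
    by (intro exI[of _ "{}"] conjI allI impI exI[of _ 1] exI[of _ 0] ballI) (auto simp: h)
  moreover have "(h has_real_derivative 2 powi 0) (at x within {0..1})" if "x \<in> {0..1}" for x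
    by (rule has_field_derivative_transform_within[of "\<lambda>x. x" _ x _ 1]) (use that in \<open>auto simp: h\<close>)
  then have "\<exists>D. finite D \<and> D \<subseteq> dyadic_rationals \<and> (\<forall>x\<in>{0..1} - D. \<exists>k::int.
      (h has_real_derivative 2 powi k) (at x within {0..1}))"
    by (intro exI[of _ "{}"]) blast
  ultimately have "h \<in> carrier thompson_F" by (auto simp: thompson_F_def h_def)
  then show ?thesis by (simp add: thompson_F_def h_def)
qed

lemma thompson_F_inverse:
  assumes f: "f \<in> carrier thompson_F"
  obtains g where "g \<in> carrier thompson_F" "\<And>t. t \<in> {0..1} \<Longrightarrow> g (f t) = t"
proof -
  obtain f' where f': "homeomorphism {0..1} {0..1} f f'"
    using f by (auto simp: thompson_F_def)
  define g where "g = restrict f' {0..1}"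
  have hom: "homeomorphism {0..1} {0..1} g f"
    using homeomorphism_symD[OF f'] by (rule homeomorphism_cong) (auto simp: g_def)
  have gf: "g (f t) = t" and fg: "f (g t) = t" and gin: "g t \<in> {0..1}" if "t \<in> {0..1}" for t
    using hom that unfolding homeomorphism_def by blast+
  have fin: "f t \<in> {0..1}" if "t \<in> {0..1}" for t using thompson_F_in[OF f that] .
  have less: "g x < g y \<longleftrightarrow> x < y" if "x \<in> {0..1}" "y \<in> {0..1}" for x y
    using thompson_F_less_iff[OF f gin gin, OF that] fg that by simp
  have le: "g x \<le> g y \<longleftrightarrow> x \<le> y" if "x \<in> {0..1}" "y \<in> {0..1}" for x y
    using less[OF that(2,1)] by auto
  have mono: "strict_mono_on {0..1} g" using less by (auto simp: strict_mono_on_def)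
  have ext: "g \<in> extensional {0..1}" by (simp add: g_def)
  obtain P where P: "finite P" "\<And>a b. 0 \<le> a \<Longrightarrow> a < b \<Longrightarrow> b \<le> 1 \<Longrightarrow> {a<..<b} \<inter> P = {} \<Longrightarrow>
      \<exists>m c. \<forall>t\<in>{a..b}. f t = m * t + c"
    using f by (auto simp: thompson_F_def piecewise_linear_def)
  have pl: "piecewise_linear g"
    unfolding piecewise_linear_def
  proof (intro exI[of _ "f ` P"] conjI allI impI)
    show "finite (f ` P)" using P(1) by simp
    fix a b :: real
    assume *: "0 \<le> a \<and> a < b \<and> b \<le> 1 \<and> {a<..<b} \<inter> f ` P = {}"
    have ab: "a \<in> {0..1}" "b \<in> {0..1}" using * by auto
    have "{g a<..<g b} \<inter> P = {}"
    proof (rule ccontr)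
      assume "{g a<..<g b} \<inter> P \<noteq> {}"
      then obtain p where p: "g a < p" "p < g b" "p \<in> P" by auto
      have p1: "p \<in> {0..1}" using p gin[OF ab(1)] gin[OF ab(2)] by auto
      have "a < f p" "f p < b"
        using p less[OF ab(1) fin[OF p1]] less[OF fin[OF p1] ab(2)] gf[OF p1] by auto
      then show False using * p by auto
    qed
    moreover have gg: "0 \<le> g a" "g a < g b" "g b \<le> 1"
      using gin[OF ab(1)] gin[OF ab(2)] less[OF ab] * by auto
    ultimately obtain m c where mc: "\<And>t. t \<in> {g a..g b} \<Longrightarrow> f t = m * t + c"
      using P(2)[of "g a" "g b"] by blast
    have "m \<noteq> 0" using mc[of "g a"] mc[of "g b"] gg fg[OF ab(1)] fg[OF ab(2)] * by auto
    have "g t = (1 / m) * t + (- c / m)" if t: "t \<in> {a..b}" for t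
    proof -
      have t1: "t \<in> {0..1}" using t * by auto
      have "g t \<in> {g a..g b}" using t le[OF ab(1) t1] le[OF t1 ab(2)] by auto
      then have "t = m * g t + c" using mc fg[OF t1] by metis
      then have "m * g t = t - c" by simp
      then show ?thesis using \<open>m \<noteq> 0\<close> by (simp add: field_simps)
    qed
    then show "\<exists>m c. \<forall>t\<in>{a..b}. g t = m * t + c" by blast
  qed
  obtain D where D: "finite D" "D \<subseteq> dyadic_rationals" "{0, 1} \<subseteq> D"
    and der: "\<forall>x\<in>{0..1} - D. \<exists>k::int. (f has_real_derivative 2 powi k) (at x)"
    using thompson_F_breaks[OF f] by metis
  have "\<exists>k::int. (g has_real_derivative 2 powi k) (at y within {0..1})"
    if y: "y \<in> {0..1} - f ` (D \<inter> {0..1})" for y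
  proof -
    have y1: "y \<in> {0..1}" using y by auto
    have "g y \<notin> D" using y gin[OF y1] fg[OF y1] by (metis DiffE IntI imageI)
    then obtain k :: int where k: "DERIV f (g y) :> 2 powi k" using der gin[OF y1] by blast
    have "0 \<in> D \<inter> {0..1}" "1 \<in> D \<inter> {0..1}" using D(3) by auto
    then have "f 0 \<noteq> y" "f 1 \<noteq> y" using y by blast+
    then have y01: "0 < y" "y < 1" using y1 thompson_FD(5,6)[OF f] by auto
    have "continuous_on {0..1} g" using hom by (simp add: homeomorphism_def)
    then have "isCont g y" using y01 by (intro continuous_on_interior) auto
    then have "DERIV g y :> inverse (2 powi k)"
      by (intro DERIV_inverse_function[where f = f and a = 0 and b = 1]) (use k y01 fg in auto)
    then have "(g has_real_derivative 2 powi (- k)) (at y within {0..1})"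
      by (simp add: power_int_minus has_field_derivative_at_within)
    then show ?thesis by blast
  qed
  moreover have "finite (f ` (D \<inter> {0..1}))" using D by auto
  moreover have "f ` (D \<inter> {0..1}) \<subseteq> dyadic_rationals"
    using D(2) thompson_F_dyadic[OF f] by blast
  ultimately have "\<exists>D. finite D \<and> D \<subseteq> dyadic_rationals \<and> (\<forall>x\<in>{0..1} - D. \<exists>k::int.
      (g has_real_derivative 2 powi k) (at x within {0..1}))"
    by blast
  then have "g \<in> carrier thompson_F" using ext mono hom pl by (auto simp: thompson_F_def)
  then show ?thesis using that gf by blast
qed

lemma thompson_F_eqI:
  assumes "f \<in> carrier thompson_F" "g \<in> carrier thompson_F" "\<And>t. t \<in> {0..1} \<Longrightarrow> f t = g t"
  shows "f = g"
  using extensionalityI[OF thompson_FD(1)[OF assms(1)] thompson_FD(1)[OF assms(2)]] assms(3) by blast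

lemma thompson_F_one_apply: "x \<in> {0..1} \<Longrightarrow> \<one>\<^bsub>thompson_F\<^esub> x = x"
  by (simp add: thompson_F_def)

lemma group_thompson_F: "group thompson_F"
proof (rule groupI)
  fix f g h assume f: "f \<in> carrier thompson_F" and g: "g \<in> carrier thompson_F"
    and h: "h \<in> carrier thompson_F"
  show "f \<otimes>\<^bsub>thompson_F\<^esub> g \<otimes>\<^bsub>thompson_F\<^esub> h = f \<otimes>\<^bsub>thompson_F\<^esub> (g \<otimes>\<^bsub>thompson_F\<^esub> h)"
    by (rule thompson_F_eqI)
      (use f g h thompson_F_in[OF f] in \<open>auto simp: thompson_F_mult_apply thompson_F_mult_closed\<close>)
next
  fix f assume f: "f \<in> carrier thompson_F"
  show "\<one>\<^bsub>thompson_F\<^esub> \<otimes>\<^bsub>thompson_F\<^esub> f = f"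
    by (rule thompson_F_eqI)
      (use f in \<open>auto simp: thompson_F_mult_apply thompson_F_one_apply thompson_F_mult_closed
         thompson_F_one_closed\<close>)
  obtain g where g: "g \<in> carrier thompson_F" "\<And>t. t \<in> {0..1} \<Longrightarrow> g (f t) = t"
    using thompson_F_inverse[OF f] by metis
  obtain h where h: "h \<in> carrier thompson_F" "\<And>t. t \<in> {0..1} \<Longrightarrow> h (g t) = t"
    using thompson_F_inverse[OF g(1)] by metis
  have hf: "h t = f t" if "t \<in> {0..1}" for t
    using h(2)[OF thompson_F_in[OF f that]] g(2)[OF that] by simp
  have "g \<otimes>\<^bsub>thompson_F\<^esub> f = \<one>\<^bsub>thompson_F\<^esub>"
  proof (rule thompson_F_eqI)
    fix t :: real assume t: "t \<in> {0..1}"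
    show "(g \<otimes>\<^bsub>thompson_F\<^esub> f) t = \<one>\<^bsub>thompson_F\<^esub> t"
      using h(2)[OF t] hf[OF thompson_F_in[OF g(1) t]] t
      by (simp add: thompson_F_mult_apply thompson_F_one_apply)
  qed (use f g in \<open>auto simp: thompson_F_mult_closed thompson_F_one_closed\<close>)
  then show "\<exists>g\<in>carrier thompson_F. g \<otimes>\<^bsub>thompson_F\<^esub> f = \<one>\<^bsub>thompson_F\<^esub>" using g by blast
qed (auto simp: thompson_F_mult_closed thompson_F_one_closed)

lemma thompson_x0_closed: "thompson_x0 \<in> carrier thompson_F"
proof -
  define g :: "real \<Rightarrow> real" where
    "g = (\<lambda>t. if t \<le> 1/4 then 2 * t else if t \<le> 1/2 then t + 1/4 else (t + 1) / 2)"
  have f: "thompson_x0 t = (if t \<le> 1/2 then t / 2 else if t \<le> 3/4 then t - 1/4 else 2 * t - 1)"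
    if "t \<in> {0..1}" for t
    using that by (simp add: thompson_x0_def)
  have f': "thompson_x0 t = max (t / 2) (t - 1/4) + max 0 (t - 3/4)"
    if "t \<in> {0..1}" for t
    using f[OF that] by (auto simp: min_def max_def field_simps)
  have g': "g t = min (2 * t) (min (t + 1/4) ((t + 1) / 2))" for t
    by (auto simp: g_def min_def field_simps)
  have cf: "continuous_on {0..1} thompson_x0"
    by (rule continuous_on_eq[of _ "\<lambda>t. max (t / 2) (t - 1/4) + max 0 (t - 3/4)"])
      (auto simp: f' intro!: continuous_intros)
  have cg: "continuous_on {0..1} g" unfolding g' by (intro continuous_intros) auto
  have "homeomorphism {0..1} {0..1} thompson_x0 g"
    by (rule homeomorphismI[OF cf cg]) (auto simp: f g_def field_simps)
  moreover have "strict_mono_on {0..1} thompson_x0" by (auto simp: strict_mono_on_def f)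
  moreover have "piecewise_linear thompson_x0"
    unfolding piecewise_linear_def
  proof (intro exI[of _ "{1/2, 3/4}"] conjI allI impI)
    fix a b :: real
    assume *: "0 \<le> a \<and> a < b \<and> b \<le> 1 \<and> {a<..<b} \<inter> {1/2, 3/4} = {}"
    then have "b \<le> 1/2 \<or> (1/2 \<le> a \<and> b \<le> 3/4) \<or> 3/4 \<le> a" by auto
    then consider "b \<le> 1/2" | "1/2 \<le> a" "b \<le> 3/4" | "3/4 \<le> a" by blast
    then show "\<exists>m c. \<forall>t\<in>{a..b}. thompson_x0 t = m * t + c"
    proof cases
      case 1
      then show ?thesis using * by (intro exI[of _ "1/2"] exI[of _ 0]) (auto simp: f)
    next
      case 2
      then show ?thesis using * by (intro exI[of _ 1] exI[of _ "-1/4"]) (auto simp: f)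
    next
      case 3
      then show ?thesis using * by (intro exI[of _ 2] exI[of _ "-1"]) (auto simp: f)
    qed
  qed simp
  moreover have "\<exists>D. finite D \<and> D \<subseteq> dyadic_rationals \<and> (\<forall>x\<in>{0..1} - D. \<exists>k::int.
      (thompson_x0 has_real_derivative 2 powi k) (at x within {0..1}))"
  proof (intro exI[of _ "{1/2, 3/4}"] conjI ballI)
    have "(1/2::real) = of_int 1 / 2 ^ 1" "(3/4::real) = of_int 3 / 2 ^ 2" by auto
    then show "{1/2, 3/4} \<subseteq> dyadic_rationals" unfolding dyadic_rationals_def by blast
    fix x :: real assume x: "x \<in> {0..1} - {1/2, 3/4}"
    then consider "x < 1/2" | "1/2 < x" "x < 3/4" | "3/4 < x" by fastforce
    then show "\<exists>k::int. (thompson_x0 has_real_derivative 2 powi k) (at x within {0..1})"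
    proof cases
      case 1
      have "((\<lambda>t. t / 2) has_real_derivative 2 powi (-1)) (at x within {0..1})"
        by (auto intro!: derivative_eq_intros)
      then have "(thompson_x0 has_real_derivative 2 powi (-1)) (at x within {0..1})"
        by (rule has_field_derivative_transform_within[of _ _ _ _ "1/2 - x"])
          (use x 1 in \<open>auto simp: f dist_real_def\<close>)
      then show ?thesis by blast
    next
      case 2
      have "((\<lambda>t. t - 1/4) has_real_derivative 2 powi 0) (at x within {0..1})"
        by (auto intro!: derivative_eq_intros)
      then have "(thompson_x0 has_real_derivative 2 powi 0) (at x within {0..1})"
        by (rule has_field_derivative_transform_within[of _ _ _ _ "min (x - 1/2) (3/4 - x)"])
          (use x 2 in \<open>auto simp: f dist_real_def\<close>)
      then show ?thesis by blast
    next
      case 3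
      have "((\<lambda>t. 2 * t - 1) has_real_derivative 2 powi 1) (at x within {0..1})"
        by (auto intro!: derivative_eq_intros)
      then have "(thompson_x0 has_real_derivative 2 powi 1) (at x within {0..1})"
        by (rule has_field_derivative_transform_within[of _ _ _ _ "x - 3/4"])
          (use x 3 in \<open>auto simp: f dist_real_def\<close>)
      then show ?thesis by blast
    qed
  qed simp
  moreover have "thompson_x0 \<in> extensional {0..1}" by (simp add: thompson_x0_def)
  ultimately show ?thesis by (auto simp: thompson_F_def)
qed

lemma thompson_x1_closed: "thompson_x1 \<in> carrier thompson_F"
proof -
  define g :: "real \<Rightarrow> real" where
    "g = (\<lambda>t. if t \<le> 1/2 then t else if t \<le> 5/8 then 2 * t - 1/2
              else if t \<le> 3/4 then t + 1/8 else (t + 1) / 2)"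
  have f: "thompson_x1 t = (if t \<le> 1/2 then t else if t \<le> 3/4 then t / 2 + 1/4
     else if t \<le> 7/8 then t - 1/8 else 2 * t - 1)"
    if "t \<in> {0..1}" for t
    using that by (simp add: thompson_x1_def)
  have f': "thompson_x1 t = min t (max (t / 2 + 1/4) (t - 1/8) + max 0 (t - 7/8))"
    if "t \<in> {0..1}" for t
    using f[OF that] that by (auto simp: min_def max_def field_simps)
  have g': "g t = max t (min (2 * t - 1/2) (min (t + 1/8) ((t + 1) / 2)))" if "t \<in> {0..1}" for t
    using that by (auto simp: g_def min_def max_def field_simps)
  have cf: "continuous_on {0..1} thompson_x1"
    by (rule continuous_on_eq[of _ "\<lambda>t. min t (max (t / 2 + 1/4) (t - 1/8) + max 0 (t - 7/8))"])
      (auto simp: f' intro!: continuous_intros)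
  have cg: "continuous_on {0..1} g"
    by (rule continuous_on_eq[of _ "\<lambda>t. max t (min (2 * t - 1/2) (min (t + 1/8) ((t + 1) / 2)))"])
      (auto simp: g' intro!: continuous_intros)
  have "homeomorphism {0..1} {0..1} thompson_x1 g"
    by (rule homeomorphismI[OF cf cg]) (auto simp: f g_def field_simps)
  moreover have "strict_mono_on {0..1} thompson_x1" by (auto simp: strict_mono_on_def f)
  moreover have "piecewise_linear thompson_x1"
    unfolding piecewise_linear_def
  proof (intro exI[of _ "{1/2, 3/4, 7/8}"] conjI allI impI)
    fix a b :: real
    assume *: "0 \<le> a \<and> a < b \<and> b \<le> 1 \<and> {a<..<b} \<inter> {1/2, 3/4, 7/8} = {}"
    then have "b \<le> 1/2 \<or> (1/2 \<le> a \<and> b \<le> 3/4) \<or> (3/4 \<le> a \<and> b \<le> 7/8) \<or> 7/8 \<le> a" by auto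
    then consider "b \<le> 1/2" | "1/2 \<le> a" "b \<le> 3/4" | "3/4 \<le> a" "b \<le> 7/8" | "7/8 \<le> a" by blast
    then show "\<exists>m c. \<forall>t\<in>{a..b}. thompson_x1 t = m * t + c"
    proof cases
      case 1
      then show ?thesis using * by (intro exI[of _ 1] exI[of _ 0]) (auto simp: f)
    next
      case 2
      then show ?thesis using * by (intro exI[of _ "1/2"] exI[of _ "1/4"]) (auto simp: f)
    next
      case 3
      then show ?thesis using * by (intro exI[of _ 1] exI[of _ "-1/8"]) (auto simp: f)
    next
      case 4
      then show ?thesis using * by (intro exI[of _ 2] exI[of _ "-1"]) (auto simp: f)
    qed
  qed simp
  moreover have "\<exists>D. finite D \<and> D \<subseteq> dyadic_rationals \<and> (\<forall>x\<in>{0..1} - D. \<exists>k::int.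
      (thompson_x1 has_real_derivative 2 powi k) (at x within {0..1}))"
  proof (intro exI[of _ "{1/2, 3/4, 7/8}"] conjI ballI)
    have "(1/2::real) = of_int 1 / 2 ^ 1" "(3/4::real) = of_int 3 / 2 ^ 2"
      "(7/8::real) = of_int 7 / 2 ^ 3" by auto
    then show "{1/2, 3/4, 7/8} \<subseteq> dyadic_rationals" unfolding dyadic_rationals_def by blast
    fix x :: real assume x: "x \<in> {0..1} - {1/2, 3/4, 7/8}"
    then consider "x < 1/2" | "1/2 < x" "x < 3/4" | "3/4 < x" "x < 7/8" | "7/8 < x" by fastforce
    then show "\<exists>k::int. (thompson_x1 has_real_derivative 2 powi k) (at x within {0..1})"
    proof cases
      case 1
      have "((\<lambda>t. t) has_real_derivative 2 powi 0) (at x within {0..1})"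
        by (auto intro!: derivative_eq_intros)
      then have "(thompson_x1 has_real_derivative 2 powi 0) (at x within {0..1})"
        by (rule has_field_derivative_transform_within[of _ _ _ _ "1/2 - x"])
          (use x 1 in \<open>auto simp: f dist_real_def\<close>)
      then show ?thesis by blast
    next
      case 2
      have "((\<lambda>t. t / 2 + 1/4) has_real_derivative 2 powi (-1)) (at x within {0..1})"
        by (auto intro!: derivative_eq_intros)
      then have "(thompson_x1 has_real_derivative 2 powi (-1)) (at x within {0..1})"
        by (rule has_field_derivative_transform_within[of _ _ _ _ "min (x - 1/2) (3/4 - x)"])
          (use x 2 in \<open>auto simp: f dist_real_def\<close>)
      then show ?thesis by blast
    next
      case 3
      have "((\<lambda>t. t - 1/8) has_real_derivative 2 powi 0) (at x within {0..1})"
        by (auto intro!: derivative_eq_intros)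
      then have "(thompson_x1 has_real_derivative 2 powi 0) (at x within {0..1})"
        by (rule has_field_derivative_transform_within[of _ _ _ _ "min (x - 3/4) (7/8 - x)"])
          (use x 3 in \<open>auto simp: f dist_real_def\<close>)
      then show ?thesis by blast
    next
      case 4
      have "((\<lambda>t. 2 * t - 1) has_real_derivative 2 powi 1) (at x within {0..1})"
        by (auto intro!: derivative_eq_intros)
      then have "(thompson_x1 has_real_derivative 2 powi 1) (at x within {0..1})"
        by (rule has_field_derivative_transform_within[of _ _ _ _ "x - 7/8"])
          (use x 4 in \<open>auto simp: f dist_real_def\<close>)
      then show ?thesis by blast
    qed
  qed simp
  moreover have "thompson_x1 \<in> extensional {0..1}" by (simp add: thompson_x1_def)
  ultimately show ?thesis by (auto simp: thompson_F_def)
qed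

lemma thompson_x_closed: "thompson_x n \<in> carrier thompson_F"
proof -
  interpret group thompson_F by (rule group_thompson_F)
  show ?thesis by (simp add: thompson_x_def thompson_x0_closed thompson_x1_closed)
qed

lemma thompson_x_0: "thompson_x 0 = thompson_x0"
  by (simp add: thompson_x_def)

lemma thompson_x_1: "thompson_x 1 = thompson_x1"
proof -
  interpret group thompson_F by (rule group_thompson_F)
  show ?thesis by (simp add: thompson_x_def thompson_x1_closed)
qed

lemma thompson_x_Suc:
  assumes "n \<ge> 1"
  shows "thompson_x (Suc n)
    = thompson_x 0 \<otimes>\<^bsub>thompson_F\<^esub> thompson_x n \<otimes>\<^bsub>thompson_F\<^esub> inv\<^bsub>thompson_F\<^esub> thompson_x 0"
proof -
  interpret group thompson_F by (rule group_thompson_F)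
  obtain m where n: "n = Suc m" using assms by (cases n) auto
  have "thompson_x0 [^]\<^bsub>thompson_F\<^esub> Suc m
      = thompson_x0 \<otimes>\<^bsub>thompson_F\<^esub> thompson_x0 [^]\<^bsub>thompson_F\<^esub> m"
    using thompson_x0_closed nat_pow_Suc2 by blast
  then show ?thesis
    by (simp add: thompson_x_def n thompson_x0_closed thompson_x1_closed m_assoc inv_mult_group
        del: nat_pow_Suc)
qed

lemma thompson_x_shift:
  assumes "n \<ge> 1"
  shows "thompson_x 0 \<otimes>\<^bsub>thompson_F\<^esub> thompson_x n
    = thompson_x (Suc n) \<otimes>\<^bsub>thompson_F\<^esub> thompson_x 0"
proof -
  interpret group thompson_F by (rule group_thompson_F)
  show ?thesis by (simp add: thompson_x_Suc[OF assms] thompson_x_closed m_assoc)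
qed

lemma thompson_x_shift_apply:
  assumes "n \<ge> 1" "t \<in> {0..1}"
  shows "thompson_x n (thompson_x0 t) = thompson_x0 (thompson_x (Suc n) t)"
  using arg_cong[OF thompson_x_shift[OF assms(1)], of "\<lambda>f. f t"] assms(2)
  by (simp add: thompson_F_mult_apply thompson_x_0)

lemma thompson_x_fix_step:
  assumes "n \<ge> 1" "t \<in> {0..1}" "thompson_x n (thompson_x0 t) = thompson_x0 t"
  shows "thompson_x (Suc n) t = t"
proof -
  have "thompson_x0 (thompson_x (Suc n) t) = thompson_x0 t"
    using thompson_x_shift_apply[OF assms(1,2)] assms(3) by simp
  then show ?thesis
    using thompson_FD(7)[OF thompson_x0_closed] thompson_F_in[OF thompson_x_closed assms(2)] assms(2)
    by (meson inj_onD)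
qed

lemma thompson_x_fix1:
  assumes "n \<ge> 1" "0 \<le> t" "t \<le> 1/2"
  shows "thompson_x n t = t"
  using assms
proof (induction n arbitrary: t rule: nat_induct_at_least)
  case base
  then show ?case using thompson_x_1 by (simp add: thompson_x1_def)
next
  case (Suc n)
  then show ?case
    by (intro thompson_x_fix_step) (auto simp: thompson_x0_def)
qed

lemma thompson_x_fix2:
  assumes "n \<ge> 2" "0 \<le> t" "t \<le> 3/4"
  shows "thompson_x n t = t"
proof -
  obtain m where m: "n = Suc m" "m \<ge> 1" using assms(1) by (cases n) auto
  have "0 \<le> thompson_x0 t" "thompson_x0 t \<le> 1/2" using assms by (auto simp: thompson_x0_def)
  then show ?thesis
    unfolding m(1) using assms m thompson_x_fix1[OF m(2)] by (intro thompson_x_fix_step) auto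
qed

lemma thompson_x_fix3:
  assumes "n \<ge> 3" "0 \<le> t" "t \<le> 7/8"
  shows "thompson_x n t = t"
proof -
  obtain m where m: "n = Suc m" "m \<ge> 2" using assms(1) by (cases n) auto
  have "0 \<le> thompson_x0 t" "thompson_x0 t \<le> 3/4" using assms by (auto simp: thompson_x0_def)
  then show ?thesis
    unfolding m(1) using assms m thompson_x_fix2[OF m(2)] by (intro thompson_x_fix_step) auto
qed

theorem thompson_x_relation:
  assumes "k < n"
  shows "thompson_x k \<otimes>\<^bsub>thompson_F\<^esub> thompson_x n
    = thompson_x (n + 1) \<otimes>\<^bsub>thompson_F\<^esub> thompson_x k"
  using assms
proof (induction k arbitrary: n)
  case 0
  then show ?case using thompson_x_shift[of n] by simp
next
  case (Suc k)
  interpret group thompson_F by (rule group_thompson_F)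
  note [simp] = thompson_x_closed
  show ?case
  proof (cases "k = 0")
    case True
    then have n: "n \<ge> 2" using Suc.prems by simp
    have "thompson_x 1 \<otimes>\<^bsub>thompson_F\<^esub> thompson_x n
      = thompson_x (n + 1) \<otimes>\<^bsub>thompson_F\<^esub> thompson_x 1"
    proof (rule thompson_F_eqI)
      fix t :: real assume t: "t \<in> {0..1}"
      have "thompson_x n (thompson_x1 t) = thompson_x1 (thompson_x (Suc n) t)"
      proof (cases "t \<le> 7/8")
        case True
        then have "0 \<le> thompson_x1 t" "thompson_x1 t \<le> 3/4" using t by (auto simp: thompson_x1_def)
        then show ?thesis
          using thompson_x_fix2[OF n] thompson_x_fix3[of "Suc n" t] True t n by simp
      next
        case False
        have q: "(7/8::real) \<in> {0..1}" by simp
        have b: "thompson_x1 s = thompson_x0 s" if "s \<in> {0..1}" "7/8 \<le> s" for s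
          using that by (auto simp: thompson_x0_def thompson_x1_def)
        have "7/8 \<le> thompson_x (Suc n) t"
          using thompson_F_le_iff[OF thompson_x_closed q t, of "Suc n"] False
            thompson_x_fix3[of "Suc n" "7/8"] n by simp
        then show ?thesis
          using b[OF t] b[OF thompson_F_in[OF thompson_x_closed t]] False
            thompson_x_shift_apply[of n t] n t by simp
      qed
      then show "(thompson_x 1 \<otimes>\<^bsub>thompson_F\<^esub> thompson_x n) t
        = (thompson_x (n + 1) \<otimes>\<^bsub>thompson_F\<^esub> thompson_x 1) t"
        using t thompson_x_1 by (simp add: thompson_F_mult_apply)
    qed auto
    then show ?thesis using True by simp
  next
    case False
    obtain m where m: "n = Suc m" "k < m" using Suc.prems by (cases n) auto
    have e: "inv\<^bsub>thompson_F\<^esub> thompson_x 0 \<otimes>\<^bsub>thompson_F\<^esub> (thompson_x 0 \<otimes>\<^bsub>thompson_F\<^esub> z) = z"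
      if "z \<in> carrier thompson_F" for z
      using that by (simp add: m_assoc[symmetric])
    have c: "thompson_x (Suc i) \<otimes>\<^bsub>thompson_F\<^esub> thompson_x (Suc j)
      = thompson_x 0 \<otimes>\<^bsub>thompson_F\<^esub> (thompson_x i \<otimes>\<^bsub>thompson_F\<^esub> thompson_x j)
        \<otimes>\<^bsub>thompson_F\<^esub> inv\<^bsub>thompson_F\<^esub> thompson_x 0" if "i \<ge> 1" "j \<ge> 1" for i j
      by (simp add: thompson_x_Suc[OF that(1)] thompson_x_Suc[OF that(2)] m_assoc e)
    show ?thesis
      using c[of k m] c[of "Suc m" k] Suc.IH[OF m(2)] False m by simp
  qed
qed

lemma word_prod_closed: "u \<in> lists thompson_gens \<Longrightarrow> word_prod thompson_F u \<in> carrier thompson_F"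
  by (induction u) (auto simp: word_prod_def thompson_F_one_closed thompson_F_mult_closed
      thompson_x_closed)

lemma thompson_x_le:
  shows "t \<in> {0..1} \<Longrightarrow> thompson_x n t \<le> t" and "\<exists>t\<in>{0..1}. thompson_x n t < t"
proof -
  interpret group thompson_F by (rule group_thompson_F)
  have "(\<forall>t\<in>{0..1}. thompson_x n t \<le> t) \<and> (\<exists>t\<in>{0..1}. thompson_x n t < t)"
  proof (cases "n = 0")
    case True
    have "thompson_x0 (1/2) < 1/2" by (simp add: thompson_x0_def)
    then show ?thesis using True
      by (auto simp: thompson_x_def thompson_x0_def intro!: bexI[of _ "1/2"])
  next
    case False
    define h where "h = thompson_x0 [^]\<^bsub>thompson_F\<^esub> (n - 1)"
    have h: "h \<in> carrier thompson_F" by (simp add: h_def thompson_x0_closed)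
    have ap: "thompson_x n t = (inv\<^bsub>thompson_F\<^esub> h) (thompson_x1 (h t))" if "t \<in> {0..1}" for t
      using False that by (simp add: thompson_x_def h_def thompson_F_mult_apply)
    have inv1: "(inv\<^bsub>thompson_F\<^esub> h) (h t) = t" if t: "t \<in> {0..1}" for t
      using thompson_F_mult_apply[OF t, of h "inv\<^bsub>thompson_F\<^esub> h"] h t
      by (simp add: thompson_F_one_apply)
    have b: "thompson_x1 t \<le> t" if "t \<in> {0..1}" for t
      using that by (auto simp: thompson_x1_def)
    have hi: "inv\<^bsub>thompson_F\<^esub> h \<in> carrier thompson_F" using h by simp
    have le: "thompson_x n t \<le> t" if t: "t \<in> {0..1}" for t
    proof -
      have ht: "h t \<in> {0..1}" using thompson_F_in[OF h t] .
      show ?thesis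
        using thompson_F_le_iff[OF hi thompson_F_in[OF thompson_x1_closed ht] ht] b[OF ht]
        by (simp add: ap[OF t] inv1[OF t])
    qed
    have "3/4 \<in> h ` {0..1}" using thompson_FD(3)[OF h] by simp
    then obtain s where s: "s \<in> {0..1}" "h s = 3/4" by force
    have q: "(3/4::real) \<in> {0..1}" by simp
    have "thompson_x1 (3/4) < 3/4" by (simp add: thompson_x1_def)
    then have "thompson_x n s < s"
      using thompson_F_less_iff[OF hi thompson_F_in[OF thompson_x1_closed q] q] inv1[OF s(1)]
      by (simp add: ap[OF s(1)] s(2))
    then show ?thesis using le s by blast
  qed
  then show "t \<in> {0..1} \<Longrightarrow> thompson_x n t \<le> t" and "\<exists>t\<in>{0..1}. thompson_x n t < t"
    by blast+
qed

text \<open>Every element of \<open>S\<close> moves some point to the left, so the root of the tree of the free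
  submonoid, the identity, is not a vertex of \<open>\<Gamma>\<^sub>S\<close>: what lies in \<open>\<Gamma>\<^sub>S\<close> is that tree with its
  root deleted.\<close>

lemma one_notin_thompson_S: "\<one>\<^bsub>thompson_F\<^esub> \<notin> thompson_S"
proof
  assume "\<one>\<^bsub>thompson_F\<^esub> \<in> thompson_S"
  then obtain n u where u: "u \<in> lists thompson_gens"
    and eq: "\<one>\<^bsub>thompson_F\<^esub> = thompson_x n \<otimes>\<^bsub>thompson_F\<^esub> word_prod thompson_F u"
    by (auto simp: thompson_S_def)
  have le: "word_prod thompson_F u t \<le> t" if "t \<in> {0..1}" for t
    using u that
  proof (induction u arbitrary: t rule: list.induct)
    case Nil
    then show ?case by (simp add: word_prod_def thompson_F_one_apply)
  next
    case (Cons a u)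
    then obtain i where a: "a = thompson_x i" by auto
    have at: "a t \<in> {0..1}" unfolding a using thompson_F_in[OF thompson_x_closed Cons.prems(2)] .
    have "word_prod thompson_F (a # u) t = word_prod thompson_F u (a t)"
      using Cons.prems(2) by (simp add: word_prod_def thompson_F_mult_apply)
    also have "\<dots> \<le> a t" using Cons.IH[OF _ at] Cons.prems(1) by simp
    also have "\<dots> \<le> t" unfolding a using thompson_x_le(1)[OF Cons.prems(2)] .
    finally show ?case .
  qed
  obtain t where t: "t \<in> {0..1}" "thompson_x n t < t" using thompson_x_le(2) by blast
  have "t = word_prod thompson_F u (thompson_x n t)"
    using arg_cong[OF eq, of "\<lambda>f. f t"] t(1)
    by (simp add: thompson_F_one_apply thompson_F_mult_apply)
  also have "\<dots> \<le> thompson_x n t"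
    using le thompson_F_in[OF thompson_x_closed t(1)] by blast
  finally show False using t(2) by simp
qed

end

theory Submission
  imports Defs
begin

text \<open>A word of length \<open>l\<close> over \<open>{x\<^sub>0, x\<^sub>1}\<close> acts near \<open>1\<close> by \<open>1 - s \<mapsto> 1 - 2\<^sup>l s\<close>, and it does so on
  the whole preimage of \<open>[3/4, 1]\<close>. Hence elements can be compared at a point \<open>1 - 2\<^sup>-\<^sup>j\<close> that is
  carried to \<open>3/4\<close> just before the last letter acts. Since \<open>x\<^sub>0\<close> and \<open>x\<^sub>1\<close> take different values
  at \<open>3/4\<close>, the last letter of a word can be read off, which gives freeness. A leading \<open>x\<^sub>n\<close>
  leaves a trace in the value at the single point \<open>1 - 2\<^sup>-\<^sup>(\<^sup>n\<^sup>+\<^sup>1\<^sup>)\<close>, because it moves this point to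
  \<open>1 - 3 \<cdot> 2\<^sup>-\<^sup>(\<^sup>n\<^sup>+\<^sup>2\<^sup>)\<close>; this separates \<open>x\<^sub>n v\<close> with \<open>v\<close> short from all other words. For
  \<open>x\<^sub>n v x\<^sub>1 v'\<close> one strips common last letters; the only possible mismatch occurs when the other
  word is \<open>x\<^sub>m w x\<^sub>0 = w x\<^sub>0 x\<^sub>1\<close> with \<open>m = |w| + 2\<close>, and this is excluded because \<open>x\<^sub>n v x\<^sub>1 v'\<close> is
  not in the free submonoid.\<close>

declare in_listsD [rule del]

interpretation F: group thompson_F
  by (rule group_thompson_F)

abbreviation (input) F_mult :: "(real \<Rightarrow> real) \<Rightarrow> (real \<Rightarrow> real) \<Rightarrow> real \<Rightarrow> real" (infixl \<open>\<cdot>\<close> 70) where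
  "f \<cdot> g \<equiv> f \<otimes>\<^bsub>thompson_F\<^esub> g"

abbreviation (input) word_F :: "(real \<Rightarrow> real) list \<Rightarrow> real \<Rightarrow> real" where
  "word_F \<equiv> word_prod thompson_F"

subsection \<open>Values near the right endpoint\<close>

lemma gen_closed: "a \<in> thompson_gens \<Longrightarrow> a \<in> carrier thompson_F"
  using thompson_x_closed by auto

lemmas F_closed [simp] = thompson_x_closed word_prod_closed gen_closed

lemma word_F_Nil [simp]: "word_F [] = \<one>\<^bsub>thompson_F\<^esub>"
  by (simp add: word_prod_def)

lemma word_F_Cons: "word_F (a # u) = a \<cdot> word_F u"
  by (simp add: word_prod_def)

lemma word_F_append:
  "u \<in> lists thompson_gens \<Longrightarrow> v \<in> lists thompson_gens \<Longrightarrow> word_F (u @ v) = word_F u \<cdot> word_F v"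
  by (induction u) (auto simp: word_F_Cons F.m_assoc)

lemma word_F_snoc:
  "u \<in> lists thompson_gens \<Longrightarrow> a \<in> thompson_gens \<Longrightarrow> word_F (u @ [a]) = word_F u \<cdot> a"
  using word_F_append[of u "[a]"] by (auto simp: word_F_Cons)

lemma mult_word_F_snoc:
  "g \<in> carrier thompson_F \<Longrightarrow> u \<in> lists thompson_gens \<Longrightarrow> a \<in> thompson_gens
    \<Longrightarrow> g \<cdot> word_F (u @ [a]) = g \<cdot> word_F u \<cdot> a"
  by (simp add: word_F_snoc F.m_assoc)

text \<open>On \<open>[7/8, 1]\<close>, the last linear piece of \<open>x_1\<close>, both generators
  have slope 2 and fix 1.\<close>

lemma gen_near_one:
  "a \<in> thompson_gens \<Longrightarrow> 0 \<le> s \<Longrightarrow> s \<le> 1/8 \<Longrightarrow> a (1 - s) = 1 - 2 * s"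
  using thompson_x_0 thompson_x_1 by (auto simp: thompson_x0_def thompson_x1_def)

text \<open>The arguments are the three positions in \<open>x_word_test_point\<close>. The
  generators differ at 3/4 and agree at 7/8. The only value shared by different arguments is 5/8,
  taken by \<open>x_1\<close> at 3/4 and by \<open>x_0\<close> at 13/16; this is the collision to be
  excluded later.\<close>

lemma gen_values:
  "thompson_x 0 (3/4) = 1/2" "thompson_x 1 (3/4) = 5/8"
  "thompson_x 0 (13/16) = 5/8" "thompson_x 1 (13/16) = 11/16"
  "thompson_x 0 (7/8) = 3/4" "thompson_x 1 (7/8) = 3/4"
  using thompson_x_0 thompson_x_1 by (auto simp: thompson_x0_def thompson_x1_def)

text \<open>The bound on \<open>s\<close> keeps every letter in the slope-2 range of
  \<open>gen_near_one\<close>: the last one acts at distance at most 1/8 from 1.\<close>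

lemma word_near_one:
  "u \<in> lists thompson_gens \<Longrightarrow> 0 \<le> s \<Longrightarrow> 2 ^ (length u + 2) * s \<le> 1
    \<Longrightarrow> word_F u (1 - s) = 1 - 2 ^ length u * s"
proof (induction u arbitrary: s)
  case Nil
  then show ?case by (simp add: thompson_F_one_apply)
next
  case (Cons a u)
  have "8 * s \<le> 2 ^ (length (a # u) + 2) * s"
    by (rule mult_right_mono[OF _ Cons.prems(2)]) simp
  then have s: "s \<le> 1/8" using Cons.prems(3) by simp
  have "word_F (a # u) (1 - s) = word_F u (1 - 2 * s)"
    using Cons.prems s gen_near_one[of a s] by (simp add: word_F_Cons thompson_F_mult_apply)
  also have "\<dots> = 1 - 2 ^ length u * (2 * s)"
    using Cons.prems by (intro Cons.IH) (auto simp: algebra_simps)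
  finally show ?case by simp
qed

text \<open>The relation \<open>x_0 x_n = x_(n+1) x_0\<close> is evaluated at \<open>1 - s\<close>.
  As \<open>x_0\<close> is injective and doubles the distance from 1 on \<open>[3/4, 1]\<close>, a
  value of \<open>x_n\<close> determines one of \<open>x_(n+1)\<close> at half the distance.\<close>

lemma thompson_x_step:
  assumes n: "n \<ge> 1" and s: "0 \<le> s" "s \<le> 1/4" and r: "0 \<le> r" "r \<le> 1/4"
    and eq: "thompson_x n (1 - 2 * s) = 1 - 2 * r"
  shows "thompson_x (Suc n) (1 - s) = 1 - r"
proof -
  have x0: "thompson_x0 (1 - q) = 1 - 2 * q" if "0 \<le> q" "q \<le> 1/4" for q
    using that by (auto simp: thompson_x0_def)
  have t: "1 - s \<in> {0..1}" "1 - r \<in> {0..1}" using s r by auto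
  have "thompson_x0 (thompson_x (Suc n) (1 - s)) = thompson_x0 (1 - r)"
    using thompson_x_shift_apply[OF n t(1)] x0[OF s] x0[OF r] eq by simp
  then show ?thesis
    using thompson_FD(7)[OF thompson_x0_closed] thompson_F_in[OF thompson_x_closed t(1)] t(2)
    by (meson inj_onD)
qed

lemma thompson_x_fix:
  "s \<le> 1 \<Longrightarrow> 1 \<le> 2 ^ n * s \<Longrightarrow> thompson_x n (1 - s) = 1 - s"
proof (induction n arbitrary: s)
  case 0
  then show ?case using thompson_x_0 by (simp add: thompson_x0_def)
next
  case (Suc n)
  have pos: "0 \<le> s"
  proof (rule ccontr)
    assume "\<not> 0 \<le> s"
    then have "2 ^ Suc n * s \<le> 0" by (intro mult_nonneg_nonpos) auto
    then show False using Suc.prems(2) by linarith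
  qed
  \<comment> \<open>\<open>thompson_x_step\<close> needs index at least 1 and
    \<open>s \<le> 1/4\<close>; the target index 1 and the points of \<open>[0, 3/4]\<close> are
    covered by the earlier fixed-point lemmas.\<close>
  consider "n = 0" | "n \<ge> 1" "s \<ge> 1/4" | "n \<ge> 1" "s \<le> 1/4" by fastforce
  then show ?case
  proof cases
    case 1
    then show ?thesis using thompson_x_fix1[of "Suc n" "1 - s"] Suc.prems by simp
  next
    case 2
    then show ?thesis using thompson_x_fix2[of "Suc n" "1 - s"] Suc.prems by simp
  next
    case 3
    then show ?thesis using Suc.IH[of "2 * s"] Suc.prems pos
      by (intro thompson_x_step) (auto simp: algebra_simps)
  qed
qed

text \<open>The last linear piece of \<open>x_n\<close> has slope 2 and length
  \<open>2^(-(n+2))\<close>. The induction starts afresh at \<open>x_1\<close>, since conjugation by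
  \<open>x_0\<close> leads from \<open>x_n\<close> to \<open>x_(n+1)\<close> only for
  \<open>n \<ge> 1\<close>.\<close>

lemma thompson_x_double:
  "0 \<le> s \<Longrightarrow> 2 ^ (n + 2) * s \<le> 1 \<Longrightarrow> thompson_x n (1 - s) = 1 - 2 * s"
proof (induction n arbitrary: s)
  case 0
  then show ?case using thompson_x_0 by (auto simp: thompson_x0_def)
next
  case (Suc n)
  show ?case
  proof (cases "n = 0")
    case True
    then show ?thesis using gen_near_one[of "thompson_x 1" s] Suc.prems by simp
  next
    case False
    have "(2::real) ^ 3 * s \<le> 2 ^ (Suc n + 2) * s"
      by (intro mult_right_mono power_increasing Suc.prems) auto
    then have "s \<le> 1/8" using Suc.prems(2) by simp
    then show ?thesis using Suc.IH[of "2 * s"] Suc.prems False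
      by (intro thompson_x_step) (auto simp: algebra_simps)
  qed
qed

text \<open>Here the distance from 1 is multiplied by 3/2, which, unlike the factors 1 and 2 of the
  fixed part and the slope-2 part, is not a power of 2. This is the trace that identifies
  \<open>n\<close>.\<close>

lemma thompson_x_break: "thompson_x n (1 - 1 / 2 ^ (n + 1)) = 1 - 3 / 2 ^ (n + 2)"
proof (induction n)
  case 0
  then show ?case using thompson_x_0 by (simp add: thompson_x0_def)
next
  case (Suc n)
  show ?case
  proof (cases "n = 0")
    case True
    then show ?thesis using gen_values(2) by (simp add: thompson_x_1)
  next
    case False
    have "(2::real) ^ 1 \<le> 2 ^ n" using False by (intro power_increasing) auto
    then show ?thesis using Suc.IH False
      by (intro thompson_x_step) (auto simp: field_simps)
  qed
qed

lemma dyadic_point_mem: "1 - 1 / 2 ^ j \<in> {0..1::real}"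
  by simp

text \<open>The point \<open>1 - 2^(-j)\<close> may lie in the slope-2 part of \<open>x_n\<close>
  (here), in its fixed part (\<open>x_word_fix\<close>) or, for \<open>j = n + 1\<close>, at its
  break (\<open>x_word_break\<close>). The bound on \<open>length u\<close> leaves room for
  \<open>u\<close> to double the resulting distance at every letter.\<close>

lemma x_word_double:
  assumes "u \<in> lists thompson_gens" "n + 2 \<le> j" "length u + 3 \<le> j"
  shows "(thompson_x n \<cdot> word_F u) (1 - 1 / 2 ^ j) = 1 - 2 ^ (length u + 1) / 2 ^ j"
proof -
  have le: "2 ^ i * (1 / 2 ^ j) \<le> (1::real)" if "i \<le> j" for i
    using that by (simp add: field_simps)
  have "thompson_x n (1 - 1 / 2 ^ j) = 1 - 2 * (1 / 2 ^ j)"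
    using assms le[of "n + 2"] by (intro thompson_x_double) auto
  moreover have "word_F u (1 - 2 * (1 / 2 ^ j)) = 1 - 2 ^ length u * (2 * (1 / 2 ^ j))"
    using assms le[of "length u + 3"] by (intro word_near_one) (auto simp: power_add)
  ultimately show ?thesis
    using thompson_F_mult_apply[OF dyadic_point_mem] by simp
qed

lemma x_word_fix:
  assumes "u \<in> lists thompson_gens" "j \<le> n" "length u + 2 \<le> j"
  shows "(thompson_x n \<cdot> word_F u) (1 - 1 / 2 ^ j) = 1 - 2 ^ length u / 2 ^ j"
proof -
  have "thompson_x n (1 - 1 / 2 ^ j) = 1 - 1 / 2 ^ j"
    using assms by (intro thompson_x_fix) (auto simp: field_simps)
  moreover have "(2::real) ^ (length u + 2) \<le> 2 ^ j"
    using assms by (intro power_increasing) auto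
  then have "word_F u (1 - 1 / 2 ^ j) = 1 - 2 ^ length u * (1 / 2 ^ j)"
    using assms by (intro word_near_one) (auto simp: field_simps)
  ultimately show ?thesis
    using thompson_F_mult_apply[OF dyadic_point_mem] by simp
qed

lemma x_word_break:
  assumes "u \<in> lists thompson_gens" "length u + 2 \<le> n"
  shows "(thompson_x n \<cdot> word_F u) (1 - 1 / 2 ^ (n + 1)) = 1 - 2 ^ length u * (3 / 2 ^ (n + 2))"
proof -
  have "(2::real) ^ (length u + 2) \<le> 2 ^ n"
    using assms by (intro power_increasing) auto
  \<comment> \<open>This is the bound of \<open>word_near_one\<close> for
    \<open>s = 3 / 2^(n+2)\<close>; even \<open>4 * 2 ^ length u\<close> is at most
    \<open>2 ^ n\<close>.\<close>
  then have "3 * 2 ^ length u \<le> (2::real) ^ n"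
    using zero_le_power[of "2::real" "length u", OF zero_le_numeral]
    unfolding power_add power2_eq_square by linarith
  then have "word_F u (1 - 3 / 2 ^ (n + 2)) = 1 - 2 ^ length u * (3 / 2 ^ (n + 2))"
    using assms by (intro word_near_one) (auto simp: field_simps)
  then show ?thesis
    using thompson_F_mult_apply[OF dyadic_point_mem] thompson_x_break by metis
qed

lemma word_at_dyadic:
  assumes "u \<in> lists thompson_gens" "length u + 2 \<le> j"
  shows "word_F u (1 - 1 / 2 ^ j) = 1 - 2 ^ length u / 2 ^ j"
proof -
  have "(2::real) ^ (length u + 2) \<le> 2 ^ j" using assms by (intro power_increasing) auto
  then show ?thesis
    using word_near_one[OF assms(1), of "1 / 2 ^ j"] by (simp add: field_simps)
qed

subsection \<open>Comparison of words\<close>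

text \<open>Near 1 the slope of a word is 2 to the power of its length. The exponent
  \<open>length u + length w + 2\<close> puts the point in range for both words.\<close>

lemma word_F_length:
  assumes "u \<in> lists thompson_gens" "w \<in> lists thompson_gens" "word_F u = word_F w"
  shows "length u = length w"
  using word_at_dyadic[OF assms(1), of "length u + length w + 2"]
    word_at_dyadic[OF assms(2), of "length u + length w + 2"] assms(3) by simp

text \<open>A leading \<open>x_n\<close> also has slope 2 near 1 and so counts as one letter, on
  either side. The summands \<open>n\<close> and \<open>m\<close> in the exponent bring the point
  into the slope-2 parts of both.\<close>

lemma x_word_length:
  assumes "u \<in> lists thompson_gens" "w \<in> lists thompson_gens"
    "thompson_x n \<cdot> word_F u = thompson_x m \<cdot> word_F w"
  shows "length u = length w"
  using x_word_double[OF assms(1), of n "n + m + length u + length w + 3"]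
    x_word_double[OF assms(2), of m "n + m + length u + length w + 3"] assms(3) by simp

lemma x_word_length_word:
  assumes "u \<in> lists thompson_gens" "w \<in> lists thompson_gens" "thompson_x n \<cdot> word_F u = word_F w"
  shows "length w = length u + 1"
proof -
  let ?j = "n + length u + length w + 3"
  have "(2::real) ^ (length u + 1) / 2 ^ ?j = 2 ^ length w / 2 ^ ?j"
    using x_word_double[OF assms(1), of n ?j] word_at_dyadic[OF assms(2), of ?j] assms(3)
    by simp
  then have "(2::real) ^ (length u + 1) = 2 ^ length w" by simp
  then show ?thesis by (metis power_inject_exp one_less_numeral_iff semiring_norm(76))
qed

lemma gen_neq: "thompson_x 0 \<noteq> thompson_x 1"
  using gen_values(1,2) by auto

lemma gen_eq_at_three_quarters:
  "a \<in> thompson_gens \<Longrightarrow> b \<in> thompson_gens \<Longrightarrow> a (3/4) = b (3/4) \<Longrightarrow> a = b"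
  using gen_values(1,2) by auto

text \<open>Freeness of the submonoid: last letters are read off and cancelled one at a
  time.\<close>

lemma word_F_inj:
  "u \<in> lists thompson_gens \<Longrightarrow> w \<in> lists thompson_gens \<Longrightarrow> word_F u = word_F w \<Longrightarrow> u = w"
proof (induction u arbitrary: w rule: rev_induct)
  case Nil
  then show ?case using word_F_length[of "[]" w] by simp
next
  case (snoc a u)
  obtain b w' where w: "w = w' @ [b]"
    using word_F_length[OF snoc.prems] by (cases w rule: rev_cases) auto
  have mem: "u \<in> lists thompson_gens" "w' \<in> lists thompson_gens"
    "a \<in> thompson_gens" "b \<in> thompson_gens" using snoc.prems w by auto
  have len: "length u = length w'" using word_F_length[OF snoc.prems] w by simp
  have eq: "word_F u \<cdot> a = word_F w' \<cdot> b"
    using snoc.prems(3) mem by (simp add: w word_F_snoc)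
  \<comment> \<open>Every word of length \<open>length u\<close> carries this point to 3/4, where
    the two generators differ.\<close>
  let ?t = "1 - 1 / 2 ^ (length u + 2) :: real"
  have "word_F u ?t = 3/4" "word_F w' ?t = 3/4"
    using word_at_dyadic[OF mem(1), of "length u + 2"] word_at_dyadic[OF mem(2), of "length u + 2"] len
    by (auto simp: power_add)
  then have "a (3/4) = b (3/4)"
    using arg_cong[OF eq, of "\<lambda>f. f ?t"] thompson_F_mult_apply[OF dyadic_point_mem] by metis
  then have ab: "a = b" using gen_eq_at_three_quarters mem by blast
  then have "word_F u = word_F w'" using eq mem F.right_cancel by simp
  then show ?case using snoc.IH mem ab w by simp
qed

lemma mult_word_F_inj:
  "g \<in> carrier thompson_F \<Longrightarrow> u \<in> lists thompson_gens \<Longrightarrow> w \<in> lists thompson_gens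
    \<Longrightarrow> g \<cdot> word_F u = g \<cdot> word_F w \<Longrightarrow> u = w"
  by (rule word_F_inj) simp_all

section \<open>Moving the leading generator through a word\<close>

text \<open>Passing a letter \<open>x_k\<close> with \<open>k < 2\<close> lowers the index by one,
  by \<open>x_(n+1) x_k = x_k x_n\<close>. Starting from \<open>length v + 2\<close>, the index
  never falls below 2, so the condition \<open>k < n\<close> of the relation holds
  throughout.\<close>

lemma x_word_slide:
  "v \<in> lists thompson_gens \<Longrightarrow> thompson_x (length v + 2) \<cdot> word_F v = word_F v \<cdot> thompson_x 2"
proof (induction v)
  case Nil
  then show ?case by (simp add: numeral_2_eq_2)
next
  case (Cons a v)
  then obtain k where k: "a = thompson_x k" "k < 2" by force
  have "thompson_x (length (a # v) + 2) \<cdot> word_F (a # v)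
      = thompson_x (length v + 2 + 1) \<cdot> thompson_x k \<cdot> word_F v"
    using Cons.prems k by (simp add: word_F_Cons F.m_assoc)
  also have "\<dots> = thompson_x k \<cdot> (thompson_x (length v + 2) \<cdot> word_F v)"
    using thompson_x_relation[of k "length v + 2"] Cons.prems k
    by (simp only: F.m_assoc[symmetric] F_closed Cons_in_lists_iff trans_less_add2)
  also have "\<dots> = word_F (a # v) \<cdot> thompson_x 2"
    using Cons k by (simp add: word_F_Cons F.m_assoc)
  finally show ?case .
qed

text \<open>One more passage, \<open>x_2 x_0 = x_0 x_1\<close>, ends inside the free submonoid. This
  is the coincidence with \<open>T\<close> in (c).\<close>

lemma x_word_x0:
  assumes "v \<in> lists thompson_gens"
  shows "thompson_x (length v + 2) \<cdot> word_F v \<cdot> thompson_x 0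
    = word_F (v @ [thompson_x 0, thompson_x 1])"
proof -
  have "thompson_x (length v + 2) \<cdot> word_F v \<cdot> thompson_x 0
      = word_F v \<cdot> (thompson_x 2 \<cdot> thompson_x 0)"
    using assms by (simp only: x_word_slide) (simp add: F.m_assoc)
  also have "\<dots> = word_F v \<cdot> (thompson_x 0 \<cdot> thompson_x 1)"
    using thompson_x_relation[of 0 1] by (simp add: numeral_2_eq_2)
  finally show ?thesis
    using assms by (simp add: word_F_append word_F_Cons)
qed

text \<open>Both sides are compared at the break of \<open>x_n\<close>. There the left side has
  distance 3 times a power of 2 from 1. For \<open>m > n\<close> the point lies in the fixed part of
  \<open>x_m\<close>, for \<open>m < n\<close> in its slope-2 part, so the right side has a power of
  2 as distance. Once \<open>m = n\<close>, freeness gives \<open>w = v\<close>.\<close>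

lemma meets_nothing_else_short:
  assumes v: "v \<in> lists thompson_gens" and l: "length v + 2 \<le> n"
  shows "meets_nothing_else n v"
  unfolding meets_nothing_else_def
proof (intro allI ballI impI)
  fix m w assume w: "w \<in> lists thompson_gens"
    and eq: "thompson_x n \<cdot> word_F v = thompson_x m \<cdot> word_F w"
  have len: "length w = length v" using x_word_length[OF v w eq] by simp
  have val: "(thompson_x m \<cdot> word_F w) (1 - 1 / 2 ^ (n + 1)) = 1 - 2 ^ length v * (3 / 2 ^ (n + 2))"
    using x_word_break[OF v l] eq by simp
  have "m = n"
  proof (rule ccontr)
    assume "m \<noteq> n"
    then consider "n + 1 \<le> m" | "m + 2 \<le> n + 1" by linarith
    then show False
    proof cases
      case 1
      then have "(2::real) ^ length v / 2 ^ (n + 1) = 2 ^ length v * (3 / 2 ^ (n + 2))"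
        using x_word_fix[OF w, of "n + 1" m] val len l by simp
      then show False by (simp add: field_simps)
    next
      case 2
      then have "(2::real) ^ (length v + 1) / 2 ^ (n + 1) = 2 ^ length v * (3 / 2 ^ (n + 2))"
        using x_word_double[OF w, of m "n + 1"] val len l by simp
      then show False by (simp add: field_simps)
    qed
  qed
  then show "m = n \<and> w = v" using eq mult_word_F_inj[OF thompson_x_closed v w] by metis
qed

section \<open>Reading off the last letter after a leading generator\<close>

text \<open>The three values belong to the slope-2 part, the break and the fixed part of
  \<open>x_n\<close>. They are the possible positions of the test point just before a further letter
  acts.\<close>

lemma x_word_test_point:
  assumes u: "u \<in> lists thompson_gens"
  shows "(thompson_x n \<cdot> word_F u) (1 - 1 / 2 ^ (length u + 3))
    = (if n \<le> length u + 1 then 3/4 else if n = length u + 2 then 13/16 else 7/8)"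
proof -
  consider "n \<le> length u + 1" | "n = length u + 2" | "length u + 3 \<le> n" by linarith
  then show ?thesis
  proof cases
    case 1
    then show ?thesis using x_word_double[OF u, of n "length u + 3"] by (simp add: power_add)
  next
    case 2
    then show ?thesis using x_word_break[OF u, of n] by (simp add: power_add numeral_3_eq_3)
  next
    case 3
    then show ?thesis using x_word_fix[OF u, of "length u + 3" n] by (simp add: power_add)
  qed
qed

text \<open>The index in \<open>thompson_x 1\<close> and the sums \<open>length v + 2\<close> stay
  as written, in the form used by \<open>gen_values\<close> and the test point lemmas.\<close>

declare One_nat_def [simp del] add_2_eq_Suc' [simp del]

lemma x_word_snoc_test_point:
  assumes "u \<in> lists thompson_gens" "a \<in> thompson_gens"
  shows "(thompson_x n \<cdot> word_F (u @ [a])) (1 - 1 / 2 ^ (length u + 3))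
    = a (if n \<le> length u + 1 then 3/4 else if n = length u + 2 then 13/16 else 7/8)"
  by (simp only: mult_word_F_snoc[OF thompson_x_closed assms]
      thompson_F_mult_apply[OF dyadic_point_mem, of "_ \<cdot> _"] x_word_test_point[OF assms(1)])

text \<open>\<open>w\<close> has one letter more than the word after \<open>x_n\<close> it is
  compared with, as \<open>x_word_length_word\<close> demands, so the same test point serves
  both.\<close>

lemma word_snoc_test_point:
  assumes "w \<in> lists thompson_gens" "a \<in> thompson_gens" "length w = l + 1"
  shows "word_F (w @ [a]) (1 - 1 / 2 ^ (l + 3)) = a (3/4)"
proof -
  have "word_F w (1 - 1 / 2 ^ (l + 3)) = 3/4"
    using word_at_dyadic[OF assms(1), of "l + 3"] assms(3) by (simp add: power_add)
  then show ?thesis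
    by (simp only: word_F_snoc[OF assms(1,2)] thompson_F_mult_apply[OF dyadic_point_mem])
qed

lemma x_word_not_in_monoid:
  assumes v: "v \<in> lists thompson_gens"
  shows "v' \<in> lists thompson_gens \<Longrightarrow> w \<in> lists thompson_gens
    \<Longrightarrow> thompson_x (length v + 2) \<cdot> word_F (v @ [thompson_x 1] @ v') \<noteq> word_F w"
proof (induction v' arbitrary: w rule: rev_induct)
  case Nil
  show ?case
  proof
    assume eq: "thompson_x (length v + 2) \<cdot> word_F (v @ [thompson_x 1] @ []) = word_F w"
    have vl: "v @ [thompson_x 1] @ [] \<in> lists thompson_gens" using v by auto
    have len: "length w = length v + 2"
      using x_word_length_word[OF vl Nil.prems(2) eq] by simp
    obtain w' b where w: "w = w' @ [b]" using len by (cases w rule: rev_cases) auto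
    have mem: "w' \<in> lists thompson_gens" "b \<in> thompson_gens" using Nil.prems w by auto
    \<comment> \<open>The index \<open>length v + 2\<close> is the break case, so \<open>x_1\<close>
      acts at 13/16 with value 11/16; at 3/4 the generators take only 1/2 and 5/8.\<close>
    have "thompson_x 1 (13/16) = b (3/4)"
      using x_word_snoc_test_point[OF v, of "thompson_x 1" "length v + 2"] eq
        word_snoc_test_point[OF mem, of "length v"] len w by simp
    then show False using mem(2) by (auto simp: gen_values)
  qed
next
  case (snoc a v')
  show ?case
  proof
    let ?n = "length v + 2" and ?u = "v @ [thompson_x 1] @ v'"
    assume "thompson_x ?n \<cdot> word_F (v @ [thompson_x 1] @ v' @ [a]) = word_F w"
    then have eq: "thompson_x ?n \<cdot> word_F (?u @ [a]) = word_F w" by simp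
    have mem: "?u \<in> lists thompson_gens" "a \<in> thompson_gens" using snoc.prems v by auto
    then have ul: "?u @ [a] \<in> lists thompson_gens" by auto
    have len: "length w = length ?u + 2"
      using x_word_length_word[OF ul snoc.prems(2) eq] by simp
    obtain w' b where w: "w = w' @ [b]" using len by (cases w rule: rev_cases) auto
    have mem': "w' \<in> lists thompson_gens" "b \<in> thompson_gens" using snoc.prems w by auto
    \<comment> \<open>The letter \<open>x_1\<close> in \<open>?u\<close> makes
      \<open>?n \<le> length ?u + 1\<close>, so now the left side also reaches 3/4 before its last
      letter.\<close>
    have "a (3/4) = b (3/4)"
      using x_word_snoc_test_point[OF mem, of ?n] word_snoc_test_point[OF mem', of "length ?u"]
        eq len w by simp
    then have "a = b" using gen_eq_at_three_quarters mem mem' by blast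
    then have "thompson_x ?n \<cdot> word_F ?u \<cdot> a = word_F w' \<cdot> a"
      using eq unfolding w mult_word_F_snoc[OF thompson_x_closed mem] word_F_snoc[OF mem'] by simp
    then have "thompson_x ?n \<cdot> word_F ?u = word_F w'"
      using mem mem' by (subst (asm) F.right_cancel) auto
    then show False using snoc.IH mem' snoc.prems by auto
  qed
qed

text \<open>Common last letters are stripped until \<open>v'\<close> is empty. A collision of
  different last letters is excluded by \<open>x_word_not_in_monoid\<close>.\<close>

lemma x_word_x1_unique:
  assumes v: "v \<in> lists thompson_gens"
  shows "v' \<in> lists thompson_gens \<Longrightarrow> w \<in> lists thompson_gens
    \<Longrightarrow> thompson_x (length v + 2) \<cdot> word_F (v @ [thompson_x 1] @ v') = thompson_x m \<cdot> word_F w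
    \<Longrightarrow> m = length v + 2 \<and> w = v @ [thompson_x 1] @ v'"
proof (induction v' arbitrary: w rule: rev_induct)
  case Nil
  let ?n = "length v + 2"
  have vl: "v @ [thompson_x 1] \<in> lists thompson_gens" using v by auto
  have eq: "thompson_x ?n \<cdot> word_F (v @ [thompson_x 1]) = thompson_x m \<cdot> word_F w"
    using Nil.prems by simp
  have len: "length w = length v + 1" using x_word_length[OF vl Nil.prems(2) eq] by simp
  obtain w' b where w: "w = w' @ [b]" using len by (cases w rule: rev_cases) auto
  have mem: "w' \<in> lists thompson_gens" "b \<in> thompson_gens" using Nil.prems w by auto
  \<comment> \<open>The value 11/16 is taken only by \<open>x_1\<close> at 13/16, which fixes both
    \<open>m\<close> and \<open>b\<close>.\<close>
  have "thompson_x 1 (13/16) = b (if m \<le> length v + 1 then 3/4 else if m = ?n then 13/16 else 7/8)"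
    using x_word_snoc_test_point[OF v, of "thompson_x 1" ?n] x_word_snoc_test_point[OF mem, of m]
      eq len w by simp
  then have mb: "m = ?n" "b = thompson_x 1"
    using mem(2) by (auto simp: gen_values split: if_splits)
  then have "v @ [thompson_x 1] = w"
    using eq by (intro mult_word_F_inj[OF thompson_x_closed vl Nil.prems(2)]) simp
  then show ?case using mb by auto
next
  case (snoc a v')
  let ?n = "length v + 2" and ?u = "v @ [thompson_x 1] @ v'"
  have eq: "thompson_x ?n \<cdot> word_F (?u @ [a]) = thompson_x m \<cdot> word_F w"
    using snoc.prems by simp
  have mem: "?u \<in> lists thompson_gens" "a \<in> thompson_gens" using snoc.prems v by auto
  then have ul: "?u @ [a] \<in> lists thompson_gens" by auto
  have len: "length w = length ?u + 1" using x_word_length[OF ul snoc.prems(2) eq] by simp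
  obtain w' b where w: "w = w' @ [b]" using len by (cases w rule: rev_cases) auto
  have mem': "w' \<in> lists thompson_gens" "b \<in> thompson_gens" using snoc.prems w by auto
  have len': "length w' = length ?u" using len w by simp
  have val: "a (3/4) = b (if m \<le> length w' + 1 then 3/4 else if m = length w' + 2 then 13/16 else 7/8)"
    using x_word_snoc_test_point[OF mem, of ?n] x_word_snoc_test_point[OF mem', of m]
      eq len' w by simp
  \<comment> \<open>Between the positions 3/4 and 13/16 the only common value is 5/8, with
    \<open>a\<close> being \<open>x_1\<close> and \<open>b\<close> being \<open>x_0\<close>.\<close>
  have "b = thompson_x 0" if m: "m = length w' + 2"
    using val m mem(2) mem'(2) by (auto simp: gen_values)
  \<comment> \<open>In the excluded case the right side is \<open>x_m w' x_0 = w' x_0 x_1\<close> by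
    \<open>x_word_x0\<close>, an element of the free submonoid, to which the left side does not
    belong.\<close>
  then have no: "m \<noteq> length w' + 2"
    using x_word_x0[OF mem'(1)] eq w mem' snoc.prems(1)
      x_word_not_in_monoid[OF v, of "v' @ [a]" "w' @ [thompson_x 0, thompson_x 1]"]
    by (auto simp: mult_word_F_snoc)
  \<comment> \<open>For larger \<open>m\<close> the right side would be 3/4, a value neither
    generator takes at 3/4.\<close>
  then have "a (3/4) = b (3/4)"
    using val mem(2) mem'(2) by (auto simp: gen_values split: if_splits)
  then have ab: "a = b" using gen_eq_at_three_quarters mem mem' by blast
  then have "thompson_x ?n \<cdot> word_F ?u \<cdot> a = thompson_x m \<cdot> word_F w' \<cdot> a"
    using eq unfolding w mult_word_F_snoc[OF thompson_x_closed mem]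
      mult_word_F_snoc[OF thompson_x_closed mem'] by simp
  then have "thompson_x ?n \<cdot> word_F ?u = thompson_x m \<cdot> word_F w'"
    using mem mem' by (subst (asm) F.right_cancel) auto
  then show ?case using snoc.IH[OF _ mem'(1)] snoc.prems ab w by auto
qed

subsection \<open>Graphs\<close>

lemma wf_cayley_graph:
  assumes "group G" "A \<subseteq> carrier G"
  shows "wf_digraph (cayley_graph G A)"
proof
  interpret group G by fact
  fix e assume "e \<in> arcs (cayley_graph G A)"
  then obtain g a where "e = (g, a, g \<otimes>\<^bsub>G\<^esub> a)" "g \<in> carrier G" "a \<in> carrier G"
    using assms(2) by (auto simp: cayley_graph_def)
  then show "tail (cayley_graph G A) e \<in> verts (cayley_graph G A)"
    "head (cayley_graph G A) e \<in> verts (cayley_graph G A)"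
    by (simp_all add: cayley_graph_def)
qed

lemma thompson_SI: "u \<in> lists thompson_gens \<Longrightarrow> thompson_x n \<cdot> word_F u \<in> thompson_S"
  unfolding thompson_S_def by blast

lemma thompson_S_carrier: "thompson_S \<subseteq> carrier thompson_F"
proof
  fix h assume "h \<in> thompson_S"
  then obtain n u where "u \<in> lists thompson_gens" "h = thompson_x n \<cdot> word_F u"
    unfolding thompson_S_def by blast
  then show "h \<in> carrier thompson_F" by simp
qed

lemma wf_thompson_cayley: "wf_digraph thompson_cayley"
  unfolding thompson_cayley_def by (rule wf_cayley_graph[OF group_thompson_F]) simp

lemma growth_graph_vertsI:
  "w \<in> lists A \<Longrightarrow> enat (length w) \<le> d
    \<Longrightarrow> r \<otimes>\<^bsub>G\<^esub> word_prod G w \<in> verts (growth_graph G A r d)"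
  unfolding growth_graph_def by (simp, intro exI[of _ w]) simp

lemma growth_graph_vertsE:
  assumes "h \<in> verts (growth_graph G A r d)"
  obtains w where "w \<in> lists A" "enat (length w) \<le> d" "h = r \<otimes>\<^bsub>G\<^esub> word_prod G w"
  using assms unfolding growth_graph_def by (simp, elim exE conjE) simp

lemma growth_graph_arcsE:
  assumes "e \<in> arcs (growth_graph G A r d)"
  obtains w a where "w \<in> lists A" "a \<in> A" "enat (length w) < d"
    "e = (r \<otimes>\<^bsub>G\<^esub> word_prod G w, a, r \<otimes>\<^bsub>G\<^esub> word_prod G w \<otimes>\<^bsub>G\<^esub> a)"
  using assms unfolding growth_graph_def by (simp, elim exE conjE) simp

lemma wf_growth_graph:
  assumes r: "r \<in> carrier thompson_F"
  shows "wf_digraph (growth_graph thompson_F thompson_gens r d)" (is "wf_digraph ?T")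
proof
  have ends: "tail ?T (g, a, h) = g" "head ?T (g, a, h) = h" for g a h
    by (simp_all add: growth_graph_def)
  fix e assume "e \<in> arcs ?T"
  then obtain w a where w: "w \<in> lists thompson_gens" "a \<in> thompson_gens" "enat (length w) < d"
    and e: "e = (r \<cdot> word_F w, a, r \<cdot> word_F w \<cdot> a)"
    by (rule growth_graph_arcsE)
  show "tail ?T e \<in> verts ?T"
    using growth_graph_vertsI[OF w(1), of d thompson_F r] w(3) by (simp add: e ends)
  have "w @ [a] \<in> lists thompson_gens" "enat (length (w @ [a])) \<le> d"
    using w by (auto simp: Suc_ile_eq simp del: insert_iff)
  then have "r \<cdot> word_F (w @ [a]) \<in> verts ?T" by (rule growth_graph_vertsI)
  then show "head ?T e \<in> verts ?T"
    by (simp only: e mult_word_F_snoc[OF r w(1,2)] ends)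
qed

lemma growth_graph_subgraph_cayley:
  assumes r: "r \<in> carrier thompson_F"
  shows "subgraph (growth_graph thompson_F thompson_gens r d) thompson_cayley" (is "subgraph ?T _")
  unfolding subgraph_def
proof (intro conjI subsetI)
  show "wf_digraph thompson_cayley" "wf_digraph ?T"
    by (rule wf_thompson_cayley, rule wf_growth_graph[OF r])
  show "compatible thompson_cayley ?T"
    by (simp add: compatible_def thompson_cayley_def cayley_graph_def growth_graph_def)
  show "h \<in> verts thompson_cayley" if "h \<in> verts ?T" for h
    using that r by (elim growth_graph_vertsE) (simp add: thompson_cayley_def cayley_graph_def)
  show "e \<in> arcs thompson_cayley" if "e \<in> arcs ?T" for e
    using that
  proof (rule growth_graph_arcsE)
    fix w a assume "w \<in> lists thompson_gens" "a \<in> thompson_gens"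
      "e = (r \<cdot> word_F w, a, r \<cdot> word_F w \<cdot> a)"
    moreover from this have "r \<cdot> word_F w \<in> carrier thompson_F" using r by simp
    ultimately show ?thesis unfolding thompson_cayley_def cayley_graph_def by simp
  qed
qed

lemma subgraph_induce_subgraph:
  assumes "subgraph H G" "verts H \<subseteq> V"
  shows "subgraph H (G \<restriction> V)"
proof -
  interpret H: wf_digraph H using assms(1) by (simp add: subgraph_def)
  have "wf_digraph (G \<restriction> V)"
    using assms(1) by (auto simp: subgraph_def intro: wf_digraph.wellformed_induce_subgraph)
  moreover have "tail G e \<in> V \<and> head G e \<in> V" if "e \<in> arcs H" for e
    using assms H.tail_in_verts[OF that] H.head_in_verts[OF that]
    by (auto simp: subgraph_def compatible_def)
  ultimately show ?thesis
    using assms H.wf_digraph by (auto simp: subgraph_def compatible_def)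
qed

text \<open>The root is a general \<open>x_n u\<close>: the empty \<open>u\<close> gives
  \<open>T_n\<close>, and \<open>u = v @ [thompson_x 1]\<close> gives the infinite tree in
  (c).\<close>

lemma growth_graph_subgraph_Gamma_S:
  assumes u: "u \<in> lists thompson_gens"
  shows "subgraph (growth_graph thompson_F thompson_gens (thompson_x n \<cdot> word_F u) d) Gamma_S"
  unfolding Gamma_S_def
proof (rule subgraph_induce_subgraph)
  show "subgraph (growth_graph thompson_F thompson_gens (thompson_x n \<cdot> word_F u) d) thompson_cayley"
    using u by (intro growth_graph_subgraph_cayley) simp
  have S: "thompson_x n \<cdot> word_F u \<cdot> word_F w \<in> thompson_S" if w: "w \<in> lists thompson_gens" for w
  proof -
    have "thompson_x n \<cdot> word_F u \<cdot> word_F w = thompson_x n \<cdot> word_F (u @ w)"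
      using u w by (simp add: word_F_append F.m_assoc)
    moreover have "u @ w \<in> lists thompson_gens" using u w by simp
    ultimately show ?thesis by (simp only: thompson_SI)
  qed
  show "verts (growth_graph thompson_F thompson_gens (thompson_x n \<cdot> word_F u) d) \<subseteq> thompson_S"
  proof
    fix h assume "h \<in> verts (growth_graph thompson_F thompson_gens (thompson_x n \<cdot> word_F u) d)"
    then show "h \<in> thompson_S" by (rule growth_graph_vertsE) (simp add: S)
  qed
qed

text \<open>The root is deleted because the identity is not in \<open>S\<close>, by
  \<open>one_notin_thompson_S\<close>. A nonempty word is in \<open>S\<close> because its first
  letter is \<open>x_0\<close> or \<open>x_1\<close>.\<close>

lemma monoid_tree_subgraph_Gamma_S:
  "subgraph (pre_digraph.del_vert monoid_tree \<one>\<^bsub>thompson_F\<^esub>) Gamma_S"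
  unfolding Gamma_S_def
proof (rule subgraph_induce_subgraph)
  have wf: "wf_digraph monoid_tree"
    unfolding monoid_tree_def by (rule wf_growth_graph) simp
  have "subgraph monoid_tree thompson_cayley"
    unfolding monoid_tree_def by (rule growth_graph_subgraph_cayley) simp
  then show "subgraph (pre_digraph.del_vert monoid_tree \<one>\<^bsub>thompson_F\<^esub>) thompson_cayley"
    using wf_digraph.subgraph_del_vert[OF wf] subgraph_trans by blast
  have "word_F w \<in> thompson_S" if w: "w \<in> lists thompson_gens" "w \<noteq> []" for w
  proof -
    obtain a u where au: "w = a # u" "u \<in> lists thompson_gens" "a \<in> thompson_gens"
      using w by (cases w) auto
    then obtain n where "a = thompson_x n" by auto
    then show ?thesis using au by (simp add: word_F_Cons thompson_SI)
  qed
  moreover have "\<exists>w. w \<in> lists thompson_gens \<and> w \<noteq> [] \<and> h = word_F w"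
    if "h \<in> verts (pre_digraph.del_vert monoid_tree \<one>\<^bsub>thompson_F\<^esub>)" for h
  proof -
    from that obtain w where "w \<in> lists thompson_gens" "h = word_F w" "h \<noteq> \<one>\<^bsub>thompson_F\<^esub>"
      by (auto simp: pre_digraph.del_vert_def monoid_tree_def growth_graph_def)
    then show ?thesis using word_F_Nil by blast
  qed
  ultimately show "verts (pre_digraph.del_vert monoid_tree \<one>\<^bsub>thompson_F\<^esub>) \<subseteq> thompson_S"
    by blast
qed

text \<open>Freeness and left cancellation make every growth graph a binary tree, whatever its root
  and depth.\<close>

lemma grows_binary_tree_F:
  assumes r: "r \<in> carrier thompson_F"
  shows "grows_binary_tree thompson_F thompson_gens r d"
  unfolding grows_binary_tree_def
proof
  show "card thompson_gens = 2" using gen_neq by simp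
  show "inj_on (\<lambda>w. r \<cdot> word_F w) {w \<in> lists thompson_gens. enat (length w) \<le> d}"
  proof (rule inj_onI)
    fix u w assume "u \<in> {w \<in> lists thompson_gens. enat (length w) \<le> d}"
      "w \<in> {w \<in> lists thompson_gens. enat (length w) \<le> d}" "r \<cdot> word_F u = r \<cdot> word_F w"
    then show "u = w" by (intro mult_word_F_inj[OF r]) simp_all
  qed
qed

section \<open>Neighbors of the boundary vertices\<close>

lemma Gamma_S_dominates_iff:
  "g \<rightarrow>\<^bsub>Gamma_S\<^esub> h \<longleftrightarrow>
     g \<in> thompson_S \<and> h \<in> thompson_S \<and> (\<exists>a\<in>thompson_gens. h = g \<cdot> a)"
proof -
  have "g \<rightarrow>\<^bsub>Gamma_S\<^esub> h \<longleftrightarrow>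
     g \<in> carrier thompson_F \<and> g \<in> thompson_S \<and> h \<in> thompson_S \<and> (\<exists>a\<in>thompson_gens. h = g \<cdot> a)"
    by (auto simp: Gamma_S_def thompson_cayley_def cayley_graph_def arcs_ends_def arc_to_ends_def
        image_iff simp del: insert_iff)
  then show ?thesis using thompson_S_carrier by blast
qed

lemma neighbors_outside_level_tree:
  assumes v: "v \<in> lists thompson_gens" and l: "length v + 2 = n"
  defines "g \<equiv> thompson_x n \<cdot> word_F v"
  shows "neighbors Gamma_S g - verts (level_tree n) = {g \<cdot> thompson_x 0, g \<cdot> thompson_x 1}"
proof -
  have T: "verts (level_tree n) = {thompson_x n \<cdot> word_F w |w. w \<in> lists thompson_gens \<and> length w \<le> n - 2}"
    by (simp add: level_tree_def growth_graph_def)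
  have up: "g \<cdot> a \<in> neighbors Gamma_S g - verts (level_tree n)" if a: "a \<in> thompson_gens" for a
  proof -
    have ga: "g \<cdot> a = thompson_x n \<cdot> word_F (v @ [a])" and va: "v @ [a] \<in> lists thompson_gens"
      using v a by (simp_all add: g_def mult_word_F_snoc)
    have "g \<cdot> a \<in> neighbors Gamma_S g"
      using thompson_SI[OF v, of n] thompson_SI[OF va, of n] a
      unfolding neighbors_def Gamma_S_dominates_iff ga[symmetric] g_def[symmetric] by blast
    moreover have "g \<cdot> a \<notin> verts (level_tree n)"
    proof
      assume "g \<cdot> a \<in> verts (level_tree n)"
      then obtain w where w: "w \<in> lists thompson_gens" "length w \<le> n - 2"
        "thompson_x n \<cdot> word_F (v @ [a]) = thompson_x n \<cdot> word_F w"
        unfolding T ga by blast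
      \<comment> \<open>By freeness a child of a boundary vertex has no shorter label; its length
        \<open>n - 1\<close> lies beyond the last level.\<close>
      then have "v @ [a] = w" using mult_word_F_inj[OF thompson_x_closed va] by blast
      then show False using w(2) l by auto
    qed
    ultimately show ?thesis by blast
  qed
  \<comment> \<open>A predecessor \<open>x_m w\<close> of \<open>g\<close> gives
    \<open>x_n v = x_m w a\<close>. Uniqueness of \<open>x_n v\<close> forces \<open>m = n\<close>
    and \<open>w @ [a] = v\<close>, so no incoming arc starts outside the tree.\<close>
  have down: "h \<in> verts (level_tree n)" if "h \<rightarrow>\<^bsub>Gamma_S\<^esub> g" for h
  proof -
    from that obtain m w a where h: "h = thompson_x m \<cdot> word_F w" "w \<in> lists thompson_gens"
      and a: "a \<in> thompson_gens" "g = h \<cdot> a"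
      unfolding Gamma_S_dominates_iff thompson_S_def by blast
    have wa: "w @ [a] \<in> lists thompson_gens" using h a by simp
    have "thompson_x n \<cdot> word_F v = thompson_x m \<cdot> word_F (w @ [a])"
      using a h by (simp add: g_def mult_word_F_snoc)
    then have m: "m = n \<and> w @ [a] = v"
      using meets_nothing_else_short[OF v eq_imp_le[OF l], unfolded meets_nothing_else_def,
          rule_format, OF wa] by blast
    then have "length w \<le> n - 2" using l by auto
    then show ?thesis unfolding T using h m by blast
  qed
  show ?thesis
  proof (intro equalityI subsetI)
    fix h assume "h \<in> neighbors Gamma_S g - verts (level_tree n)"
    then have "g \<rightarrow>\<^bsub>Gamma_S\<^esub> h" using down by (auto simp: neighbors_def)
    then show "h \<in> {g \<cdot> thompson_x 0, g \<cdot> thompson_x 1}" by (auto simp: Gamma_S_dominates_iff)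
  next
    fix h assume "h \<in> {g \<cdot> thompson_x 0, g \<cdot> thompson_x 1}"
    then show "h \<in> neighbors Gamma_S g - verts (level_tree n)" using up by auto
  qed
qed

theorem proposition6:
  shows
    (* (a) *)
    "(grows_binary_tree thompson_F thompson_gens \<one>\<^bsub>thompson_F\<^esub> \<infinity>
       \<and> subgraph monoid_tree thompson_cayley
       \<and> subgraph (pre_digraph.del_vert monoid_tree \<one>\<^bsub>thompson_F\<^esub>) Gamma_S)
    \<and> \<comment> \<open>(b)\<close>
     (\<forall>n\<ge>2.
       grows_binary_tree thompson_F thompson_gens (thompson_x n) (enat (n - 2))
       \<and> subgraph (level_tree n) Gamma_S
       \<and> (\<forall>v\<in>lists thompson_gens. length v \<le> n - 2 \<longrightarrow> meets_nothing_else n v))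
    \<and> \<comment> \<open>(c)\<close>
     (\<forall>n\<ge>2. \<forall>v\<in>lists thompson_gens. length v = n - 2 \<longrightarrow>
       (let g = thompson_x n \<otimes>\<^bsub>thompson_F\<^esub> word_prod thompson_F v;
            g0 = g \<otimes>\<^bsub>thompson_F\<^esub> thompson_x 0;
            g1 = g \<otimes>\<^bsub>thompson_F\<^esub> thompson_x 1
        in g0 \<noteq> g1
         \<and> neighbors Gamma_S g - verts (level_tree n) = {g0, g1}
         \<and> grows_binary_tree thompson_F thompson_gens g1 \<infinity>
         \<and> subgraph (growth_graph thompson_F thompson_gens g1 \<infinity>) Gamma_S
         \<and> (\<forall>v'\<in>lists thompson_gens. meets_nothing_else n (v @ [thompson_x 1] @ v'))
         \<and> g0 = word_prod thompson_F (v @ [thompson_x 0, thompson_x 1])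
         \<and> g0 \<in> verts monoid_tree))"
proof (intro conjI allI ballI impI)
  show "grows_binary_tree thompson_F thompson_gens \<one>\<^bsub>thompson_F\<^esub> \<infinity>"
    by (rule grows_binary_tree_F) simp
  show "subgraph monoid_tree thompson_cayley"
    unfolding monoid_tree_def by (rule growth_graph_subgraph_cayley) simp
  show "subgraph (pre_digraph.del_vert monoid_tree \<one>\<^bsub>thompson_F\<^esub>) Gamma_S"
    by (rule monoid_tree_subgraph_Gamma_S)
next
  fix n :: nat assume n: "n \<ge> 2"
  show "grows_binary_tree thompson_F thompson_gens (thompson_x n) (enat (n - 2))"
    by (rule grows_binary_tree_F) simp
  show "subgraph (level_tree n) Gamma_S"
    using growth_graph_subgraph_Gamma_S[of "[]" n] by (simp add: level_tree_def)
  show "meets_nothing_else n v" if "v \<in> lists thompson_gens" "length v \<le> n - 2" for v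
    using that n by (intro meets_nothing_else_short) auto
next
  fix n v assume "n \<ge> (2::nat)" and v: "v \<in> lists thompson_gens" and "length v = n - 2"
  then have n: "length v + 2 = n" by simp
  define g where "g = thompson_x n \<cdot> word_F v"
  have g: "g \<in> carrier thompson_F" using v by (simp add: g_def)
  have v1: "v @ [thompson_x 1] \<in> lists thompson_gens" using v by simp
  have g1: "g \<cdot> thompson_x 1 = thompson_x n \<cdot> word_F (v @ [thompson_x 1])"
    using v by (simp add: g_def mult_word_F_snoc)
  have g0: "g \<cdot> thompson_x 0 = word_F (v @ [thompson_x 0, thompson_x 1])"
    using x_word_x0[OF v] unfolding g_def n .
  have v01: "v @ [thompson_x 0, thompson_x 1] \<in> lists thompson_gens" using v by simp
  have "g \<cdot> thompson_x 0 \<noteq> g \<cdot> thompson_x 1"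
    using g gen_neq by simp
  moreover have "neighbors Gamma_S g - verts (level_tree n) = {g \<cdot> thompson_x 0, g \<cdot> thompson_x 1}"
    unfolding g_def by (rule neighbors_outside_level_tree[OF v n])
  moreover have "grows_binary_tree thompson_F thompson_gens (g \<cdot> thompson_x 1) \<infinity>"
    using g by (intro grows_binary_tree_F) simp
  moreover have "subgraph (growth_graph thompson_F thompson_gens (g \<cdot> thompson_x 1) \<infinity>) Gamma_S"
    unfolding g1 by (rule growth_graph_subgraph_Gamma_S[OF v1])
  moreover have "\<forall>v'\<in>lists thompson_gens. meets_nothing_else n (v @ [thompson_x 1] @ v')"
    using x_word_x1_unique[OF v] unfolding meets_nothing_else_def n by blast
  moreover have "g \<cdot> thompson_x 0 \<in> verts monoid_tree"
  proof -
    have "g \<cdot> thompson_x 0 = \<one>\<^bsub>thompson_F\<^esub> \<cdot> word_F (v @ [thompson_x 0, thompson_x 1])"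
      using g0 word_prod_closed[OF v01] by simp
    then show ?thesis
      using growth_graph_vertsI[OF v01, of \<infinity> thompson_F "\<one>\<^bsub>thompson_F\<^esub>"]
      by (simp add: monoid_tree_def del: append_in_lists_conv)
  qed
  ultimately show "let g = thompson_x n \<cdot> word_F v; g0 = g \<cdot> thompson_x 0; g1 = g \<cdot> thompson_x 1
        in g0 \<noteq> g1
         \<and> neighbors Gamma_S g - verts (level_tree n) = {g0, g1}
         \<and> grows_binary_tree thompson_F thompson_gens g1 \<infinity>
         \<and> subgraph (growth_graph thompson_F thompson_gens g1 \<infinity>) Gamma_S
         \<and> (\<forall>v'\<in>lists thompson_gens. meets_nothing_else n (v @ [thompson_x 1] @ v'))
         \<and> g0 = word_F (v @ [thompson_x 0, thompson_x 1])
         \<and> g0 \<in> verts monoid_tree"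
    using g0 unfolding Let_def g_def by blast
qed

end
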